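(* Let $p\in(0,1)$ be a constant and let $G=G_p\in\mathcal{G}_{n,p}$ be a random graph. Let $DD(G)$ be the degree-distance-based matrix of $G$, with $(i,j)$-entry $(d_i+d_j)D(i,j)$. Then $$\mathscr{E}(DD(G))=\Big(\frac{16}{3\pi}p\sqrt{p(1-p)}+o(1)\Big)n^{5/2}\quad\text{a.s.}$$
   Context: $d_i$ is the degree of vertex $i$ and $D(i,j)$ is the distance between vertices $i$ and $j$ in $G$ (so $D(i,i)=0$). The energy of a real symmetric matrix $M$ with eigenvalues $\lambda_1,\dots,\lambda_n$ is $\mathscr{E}(M)=\sum_{i=1}^n|\lambda_i|$. $\mathcal{G}_{n,p}$ is the Erdős–Rényi random graph model on $n$ vertices, each edge chosen independently with probability $p$. "a.s." means with probability tending to $1$ as $n\to\infty$; the $o(1)$ term is bounded in absolute value by a deterministic sequence tending to $0$ with probability tending to $1$. (With probability tending to $1$ the graph is connected with diameter $2$, so the convention for distances in disconnected graphs is irrelevant.) *)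

theory Defs
  imports "HOL-Probability.Probability" "Jordan_Normal_Form.Spectral_Radius"
begin

text \<open>A simple graph on the vertex set \<open>{..<n}\<close> is given by its edge set, a subset of
  \<open>all_edges n\<close>.\<close>

definition all_edges :: "nat \<Rightarrow> nat set set" where
  "all_edges n = {e. e \<subseteq> {..<n} \<and> card e = 2}"

definition degree_in :: "nat set set \<Rightarrow> nat \<Rightarrow> nat" where
  "degree_in E v = card {e \<in> E. v \<in> e}"

definition is_path :: "nat set set \<Rightarrow> nat \<Rightarrow> nat list \<Rightarrow> nat \<Rightarrow> bool" where
  "is_path E u xs v \<longleftrightarrow> xs \<noteq> [] \<and> hd xs = u \<and> last xs = v \<and> distinct xs
     \<and> successively (\<lambda>x y. {x, y} \<in> E) xs"

text \<open>The length of a path is its number of edges. Vertices in different components are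
  given distance \<open>0\<close> (an arbitrary convention).\<close>

definition graph_dist :: "nat set set \<Rightarrow> nat \<Rightarrow> nat \<Rightarrow> nat" where
  "graph_dist E u v =
     (if \<exists>xs. is_path E u xs v
      then (LEAST k. \<exists>xs. is_path E u xs v \<and> length xs = Suc k) else 0)"

definition DD_mat :: "nat \<Rightarrow> nat set set \<Rightarrow> real mat" where
  "DD_mat n E =
     mat n n (\<lambda>(i, j). real ((degree_in E i + degree_in E j) * graph_dist E i j))"

text \<open>Intended for symmetric matrices: all eigenvalues are then real, and they are summed
  with multiplicity.\<close>

definition energy :: "real mat \<Rightarrow> real" where
  "energy M = (\<Sum>x\<in>spectrum M. real (order x (char_poly M)) * \<bar>x\<bar>)"

definition gnp_pmf :: "nat \<Rightarrow> real \<Rightarrow> nat set set pmf" where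
  "gnp_pmf n p =
     map_pmf (\<lambda>f. {e \<in> all_edges n. f e}) (Pi_pmf (all_edges n) False (\<lambda>_. bernoulli_pmf p))"

end

theory Submission
  imports Defs "HOL-Real_Asymp.Real_Asymp"
begin

text \<open>
  With high probability any two vertices are adjacent or have a common neighbour. Off the diagonal
  the distance is then \<open>2 - a i j\<close>, where \<open>a i j\<close> is the indicator of the edge \<open>{i, j}\<close>, and the
  degrees equal \<open>n p\<close> up to an error of order \<open>\<surd>n\<close> in mean square. Writing
  \<open>a i j = p + \<surd>n W i j\<close> off the diagonal, with a centred matrix \<open>W\<close> of entry variance
  \<open>\<sigma>\<^sup>2 / n\<close>, \<open>\<sigma>\<^sup>2 = p (1 - p)\<close>, the degree-distance matrix becomes
  \<open>- 2 p n \<surd>n W + 2 n p (2 - p) J + R\<close> with \<open>J\<close> the all-ones matrix and a remainder \<open>R\<close> whose squared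
  Frobenius norm is of order \<open>n\<^sup>3\<close> on average. The energy is a norm (\<open>fn_energy_triangle\<close>), it is
  at most \<open>\<surd>n\<close> times the Frobenius norm, and it is \<open>n\<close> on \<open>J\<close>; so both corrections contribute only
  order \<open>n\<^sup>2\<close> (\<open>energy_DD_approx\<close>, \<open>expect_degree_defect_le\<close>). What remains is that the energy of
  \<open>W\<close> is \<open>(8 / (3 \<pi>) \<sigma> + o(1)) n\<close>, a consequence of the semicircle law.

  No closed walks are counted. Coulson's formula
  \<open>\<bar>x\<bar> = 2 / \<pi> \<integral> x\<^sup>2 / (x\<^sup>2 + y\<^sup>2) dy\<close> over \<open>y \<ge> 0\<close> expresses the energy of \<open>W\<close> through
  \<open>1 - y Im s(i y)\<close>, where \<open>s(i y)\<close> is the normalised trace of the resolvent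
  \<open>G = (W - i y)\<^sup>-\<^sup>1\<close>; only the imaginary axis is needed, where \<open>G\<close> is bounded by \<open>1 / y\<close>. A
  Bernoulli variable \<open>a\<close> satisfies an exact integration by parts,
  \<open>E[(a - p) f(a)] = p (1 - p) E[f(1) - f(0)]\<close> (\<open>expect_centred\<close>), and the resolvent identity writes
  the difference of the two resolvents as a product of resolvent entries. Applied to
  \<open>1 + i y s = (1 / n) tr (W G)\<close>, the two facts show that the defect \<open>1 + i y s + \<sigma>\<^sup>2 s\<^sup>2\<close> of the
  quadratic equation for the Stieltjes transform of the semicircle law has second moment of order
  \<open>1 / \<surd>n\<close> for every fixed \<open>y > 0\<close> (\<open>expect_defect_squared_le\<close>). The factor that completes the
  defect to its squared modulus takes part in the integration by parts; it is so insensitive to a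
  single edge that this costs only another error of the same order. Since
  \<open>Im s \<ge> 0\<close>, the value \<open>s\<close> stays away from the root in the lower half plane and a small defect forces
  \<open>s\<close> to be close to the other root (\<open>stability_at_i_y\<close>). Dominated convergence in \<open>y\<close> and the integral
  \<open>4 \<sigma> / 3\<close> of the limit (\<open>semicircle_integral\<close>) give the constant
  \<open>2 / \<pi> \<cdot> 4 \<sigma> / 3 = 8 \<sigma> / (3 \<pi>)\<close>.
\<close>

section \<open>Spectral decomposition of symmetric matrices\<close>

text \<open>The trace is the sum of the diagonal of a Schur form, that is, of the eigenvalues with
  multiplicity. If \<open>t\<close> were the only eigenvalue, the trace would be \<open>n t\<close>. This trace criterion
  replaces a dimension count when eigenvectors are produced one after the other.\<close>

lemma complex_eigenvalue_avoiding:
  fixes M :: "nat \<Rightarrow> nat \<Rightarrow> complex"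
  assumes "(\<Sum>a<n. M a a) \<noteq> of_nat n * t"
  shows "\<exists>\<mu> w. \<mu> \<noteq> t \<and> (\<exists>a<n. w a \<noteq> 0) \<and> (\<forall>a<n. (\<Sum>b<n. M a b * w b) = \<mu> * w a)"
proof -
  define A where "A = mat n n (\<lambda>(i, j). M i j)"
  have A: "A \<in> carrier_mat n n" by (simp add: A_def)
  obtain as where as: "char_poly A = (\<Prod>a\<leftarrow>as. [:- a, 1:])" "length as = n"
    using char_poly_factorized[OF A] by blast
  obtain B P Q where BPQ: "schur_decomposition A as = (B, P, Q)"
    by (cases "schur_decomposition A as") auto
  from schur_decomposition[OF A as(1) BPQ]
  have sim: "similar_mat_wit A B P Q" and diag: "diag_mat B = as" by auto
  from similar_mat_witD2[OF A sim] have
    QP: "Q * P = 1\<^sub>m n" and APQ: "A = P * B * Q" and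
    B: "B \<in> carrier_mat n n" and P: "P \<in> carrier_mat n n" and Q: "Q \<in> carrier_mat n n" by auto
  have PB: "P * B \<in> carrier_mat n n" using P B by auto
  have index_mult: "(X * Y) $$ (a, b) = (\<Sum>c<n. X $$ (a, c) * Y $$ (c, b))"
    if "X \<in> carrier_mat n n" "Y \<in> carrier_mat n n" "a < n" "b < n" for X Y :: "complex mat" and a b
    using that by (simp add: scalar_prod_def atLeast0LessThan)
  have "(\<Sum>a<n. M a a) = (\<Sum>a<n. A $$ (a, a))" by (simp add: A_def)
  also have "\<dots> = (\<Sum>a<n. \<Sum>b<n. (P * B) $$ (a, b) * Q $$ (b, a))"
    unfolding APQ by (intro sum.cong refl index_mult[OF PB Q]) auto
  also have "\<dots> = (\<Sum>b<n. \<Sum>a<n. Q $$ (b, a) * (P * B) $$ (a, b))"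
    by (subst sum.swap) (simp add: mult.commute)
  also have "\<dots> = (\<Sum>b<n. (Q * (P * B)) $$ (b, b))"
    by (intro sum.cong refl index_mult[OF Q PB, symmetric]) auto
  also have "Q * (P * B) = B" using assoc_mult_mat[OF Q P B] QP B by simp
  also have "(\<Sum>b<n. B $$ (b, b)) = sum_list as"
    using B by (auto simp: diag[symmetric] diag_mat_def sum_list_sum_nth atLeast0LessThan)
  finally have tr: "(\<Sum>a<n. M a a) = sum_list as" .
  have "\<exists>\<mu>\<in>set as. \<mu> \<noteq> t"
  proof (rule ccontr)
    assume "\<not> ?thesis"
    then have "as = replicate n t"
      using as(2) by (metis replicate_eqI)
    then have "sum_list as = of_nat n * t" by (simp add: sum_list_replicate)
    with tr assms show False by simp
  qed
  then obtain \<mu> where \<mu>: "\<mu> \<in> set as" "\<mu> \<noteq> t" by blast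
  have "poly (char_poly A) \<mu> = 0"
    unfolding as(1) using \<mu>(1) by (auto simp: poly_prod_list prod_list_zero_iff)
  then have "eigenvalue A \<mu>" using eigenvalue_root_char_poly[OF A] by simp
  then obtain w where w: "w \<in> carrier_vec n" "w \<noteq> 0\<^sub>v n" "A *\<^sub>v w = \<mu> \<cdot>\<^sub>v w"
    using A unfolding eigenvalue_def eigenvector_def by auto
  have nz: "\<exists>a<n. vec_index w a \<noteq> 0"
  proof (rule ccontr)
    assume "\<not> ?thesis"
    then have "w = 0\<^sub>v n" using w(1) by (intro eq_vecI) auto
    with w(2) show False by simp
  qed
  have ev: "(\<Sum>b<n. M a b * vec_index w b) = \<mu> * vec_index w a" if "a < n" for a
  proof -
    have "(\<Sum>b<n. M a b * vec_index w b) = vec_index (A *\<^sub>v w) a"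
      using that w(1) by (simp add: A_def scalar_prod_def atLeast0LessThan)
    also have "\<dots> = \<mu> * vec_index w a" unfolding w(3) using that w(1) by simp
    finally show ?thesis .
  qed
  show ?thesis using \<mu>(2) nz ev by (intro exI[of _ \<mu>] exI[of _ "\<lambda>a. vec_index w a"]) auto
qed

text \<open>For a symmetric real matrix the eigenvalue found above is real, because the quadratic form
  \<open>w\<^sup>* M w\<close> is its own conjugate; the real or the imaginary part of the complex eigenvector is then a
  nonzero real eigenvector.\<close>

lemma symmetric_eigenvalue_avoiding:
  fixes M :: "nat \<Rightarrow> nat \<Rightarrow> real"
  assumes sym: "\<And>i j. i < n \<Longrightarrow> j < n \<Longrightarrow> M i j = M j i"
    and tr: "(\<Sum>a<n. M a a) \<noteq> of_nat n * t"
  shows "\<exists>\<mu> w. \<mu> \<noteq> t \<and> (\<Sum>a<n. w a * w a) = 1 \<and> (\<forall>a<n. (\<Sum>b<n. M a b * w b) = \<mu> * w a)"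
proof -
  have "(\<Sum>a<n. complex_of_real (M a a)) \<noteq> of_nat n * complex_of_real t"
    using tr by (metis of_real_eq_iff of_real_mult of_real_of_nat_eq of_real_sum)
  from complex_eigenvalue_avoiding[where M = "\<lambda>a b. of_real (M a b)", OF this] obtain \<mu> w where
    \<mu>: "\<mu> \<noteq> complex_of_real t" and nz: "\<exists>a<n. w a \<noteq> 0"
    and ev: "\<And>a. a < n \<Longrightarrow> (\<Sum>b<n. of_real (M a b) * w b) = \<mu> * w a" by blast
  define N where "N = (\<Sum>a<n. (cmod (w a))\<^sup>2)"
  have N: "N > 0" unfolding N_def
    using nz by (auto intro!: sum_pos2)
  have q: "(\<Sum>a<n. cnj (w a) * (\<Sum>b<n. of_real (M a b) * w b)) = \<mu> * of_real N"
  proof -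
    have "(\<Sum>a<n. cnj (w a) * (\<Sum>b<n. of_real (M a b) * w b)) = (\<Sum>a<n. cnj (w a) * (\<mu> * w a))"
      by (intro sum.cong refl) (simp add: ev)
    also have "\<dots> = \<mu> * of_real N"
      by (simp add: N_def sum_distrib_left complex_norm_square algebra_simps del: of_real_power)
    finally show ?thesis .
  qed
  have "cnj (\<mu> * of_real N) = (\<Sum>a<n. \<Sum>b<n. w a * of_real (M a b) * cnj (w b))"
    unfolding q[symmetric] by (simp add: sum_distrib_left algebra_simps)
  also have "\<dots> = (\<Sum>b<n. \<Sum>a<n. w a * of_real (M a b) * cnj (w b))" by (rule sum.swap)
  also have "\<dots> = \<mu> * of_real N" unfolding q[symmetric]
    by (auto simp: sum_distrib_left algebra_simps sym intro!: sum.cong)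
  finally have "cnj \<mu> = \<mu>" using N by simp
  then have im: "Im \<mu> = 0" by (simp add: complex_eq_iff)
  have eRe: "(\<Sum>b<n. M a b * Re (w b)) = Re \<mu> * Re (w a)"
    and eIm: "(\<Sum>b<n. M a b * Im (w b)) = Re \<mu> * Im (w a)" if "a < n" for a
    using arg_cong[OF ev[OF that], of Re] arg_cong[OF ev[OF that], of Im] im by auto
  have "\<exists>u. (\<exists>a<n. u a \<noteq> 0) \<and> (\<forall>a<n. (\<Sum>b<n. M a b * u b) = Re \<mu> * u a)"
  proof (cases "\<exists>a<n. Re (w a) \<noteq> 0")
    case True
    then show ?thesis using eRe by (intro exI[of _ "\<lambda>a. Re (w a)"]) auto
  next
    case False
    then have "\<exists>a<n. Im (w a) \<noteq> 0" using nz by (auto simp: complex_eq_iff)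
    then show ?thesis using eIm by (intro exI[of _ "\<lambda>a. Im (w a)"]) auto
  qed
  then obtain u where u: "\<exists>a<n. u a \<noteq> 0"
    and eu: "\<And>a. a < n \<Longrightarrow> (\<Sum>b<n. M a b * u b) = Re \<mu> * u a" by blast
  define K where "K = (\<Sum>a<n. u a * u a)"
  have K: "K > 0" unfolding K_def
  proof -
    obtain a where "a < n" "u a \<noteq> 0" using u by blast
    then show "(\<Sum>a<n. u a * u a) > 0"
      by (intro sum_pos2[of _ a]) (auto simp: zero_less_mult_iff linorder_neq_iff)
  qed
  have "(\<Sum>a<n. (u a / sqrt K) * (u a / sqrt K)) = 1"
    using K by (simp add: K_def[symmetric] sum_divide_distrib[symmetric])
  moreover have "(\<Sum>b<n. M a b * (u b / sqrt K)) = Re \<mu> * (u a / sqrt K)" if "a < n" for a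
    using eu[OF that] by (simp add: sum_divide_distrib[symmetric])
  moreover have "Re \<mu> \<noteq> t" using \<mu> im by (auto simp: complex_eq_iff)
  ultimately show ?thesis by (intro exI[of _ "Re \<mu>"] exI[of _ "\<lambda>a. u a / sqrt K"]) auto
qed

definition orthonormal_eigenpairs ::
    "nat \<Rightarrow> (nat \<Rightarrow> nat \<Rightarrow> real) \<Rightarrow> nat \<Rightarrow> (nat \<Rightarrow> nat \<Rightarrow> real) \<Rightarrow> (nat \<Rightarrow> real) \<Rightarrow> bool" where
  "orthonormal_eigenpairs n M k v l \<longleftrightarrow>
     (\<forall>i<k. \<forall>j<k. (\<Sum>a<n. v i a * v j a) = of_bool (i = j)) \<and>
     (\<forall>i<k. \<forall>a<n. (\<Sum>b<n. M a b * v i b) = l i * v i a)"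

text \<open>Deflation: \<open>M' = M + \<Sum>\<^sub>i (t - l\<^sub>i) v\<^sub>i v\<^sub>i\<^sup>T\<close> moves all known eigenvalues to a common value \<open>t\<close>. If \<open>t\<close>
  avoids one particular value, then \<open>M'\<close> has an eigenvalue different from \<open>t\<close>; its eigenvector is
  orthogonal to all \<open>v\<^sub>i\<close> and therefore an eigenvector of \<open>M\<close> itself.\<close>

lemma orthonormal_eigenpairs_extend:
  fixes M :: "nat \<Rightarrow> nat \<Rightarrow> real"
  assumes sym: "\<And>i j. i < n \<Longrightarrow> j < n \<Longrightarrow> M i j = M j i"
    and ep: "orthonormal_eigenpairs n M k v l" and k: "k < n"
  shows "\<exists>v' l'. orthonormal_eigenpairs n M (Suc k) v' l'"
proof -
  have on: "\<And>i j. i < k \<Longrightarrow> j < k \<Longrightarrow> (\<Sum>a<n. v i a * v j a) = of_bool (i = j)"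
    and ev: "\<And>i a. i < k \<Longrightarrow> a < n \<Longrightarrow> (\<Sum>b<n. M a b * v i b) = l i * v i a"
    using ep by (auto simp: orthonormal_eigenpairs_def)
  (* The excluded value of t is the one for which the trace of the deflated matrix is n t. *)
  obtain t where t: "(real n - real k) * t \<noteq> (\<Sum>a<n. M a a) - (\<Sum>i<k. l i)"
  proof -
    have "(real n - real k) * (((\<Sum>a<n. M a a) - (\<Sum>i<k. l i) + 1) / (real n - real k))
       \<noteq> (\<Sum>a<n. M a a) - (\<Sum>i<k. l i)" using k by simp
    then show ?thesis using that by blast
  qed
  define M' where "M' = (\<lambda>a b. M a b + (\<Sum>i<k. (t - l i) * v i a * v i b))"
  have sym': "M' i j = M' j i" if "i < n" "j < n" for i j
    using sym that by (simp add: M'_def algebra_simps)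
  have "(\<Sum>a<n. M' a a) = (\<Sum>a<n. M a a) + (\<Sum>a<n. \<Sum>i<k. (t - l i) * (v i a * v i a))"
    by (simp add: M'_def sum.distrib mult.assoc)
  also have "(\<Sum>a<n. \<Sum>i<k. (t - l i) * (v i a * v i a)) = (\<Sum>i<k. t - l i)"
    by (subst sum.swap) (simp add: sum_distrib_left[symmetric] on)
  finally have "(\<Sum>a<n. M' a a) \<noteq> of_nat n * t"
    using t by (auto simp: sum_subtractf algebra_simps)
  from symmetric_eigenvalue_avoiding[of n M', OF sym' this] obtain \<mu> w where
    \<mu>: "\<mu> \<noteq> t" and w1: "(\<Sum>a<n. w a * w a) = 1"
    and ew: "\<And>a. a < n \<Longrightarrow> (\<Sum>b<n. M' a b * w b) = \<mu> * w a" by blast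
  have M'v: "(\<Sum>b<n. M' a b * v i b) = t * v i a" if "i < k" "a < n" for i a
  proof -
    have "(\<Sum>b<n. M' a b * v i b)
        = l i * v i a + (\<Sum>b<n. \<Sum>j<k. ((t - l j) * v j a) * (v j b * v i b))"
      using ev that by (simp add: M'_def sum.distrib distrib_right sum_distrib_right mult.assoc)
    also have "(\<Sum>b<n. \<Sum>j<k. ((t - l j) * v j a) * (v j b * v i b))
        = (\<Sum>j<k. ((t - l j) * v j a) * of_bool (j = i))"
      by (subst sum.swap) (simp add: sum_distrib_left[symmetric] on that)
    also have "\<dots> = (\<Sum>j<k. if j = i then (t - l i) * v i a else 0)" by (intro sum.cong) auto
    also have "\<dots> = (t - l i) * v i a" using that by simp
    finally show ?thesis by (simp add: algebra_simps)
  qed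
  have orth: "(\<Sum>a<n. v i a * w a) = 0" if "i < k" for i
  proof -
    have "\<mu> * (\<Sum>a<n. v i a * w a) = (\<Sum>a<n. v i a * (\<mu> * w a))"
      by (simp add: sum_distrib_left algebra_simps)
    also have "\<dots> = (\<Sum>a<n. v i a * (\<Sum>b<n. M' a b * w b))"
      by (intro sum.cong refl) (simp add: ew)
    also have "\<dots> = (\<Sum>a<n. \<Sum>b<n. v i a * M' a b * w b)"
      by (simp add: sum_distrib_left mult.assoc)
    also have "\<dots> = (\<Sum>b<n. \<Sum>a<n. v i a * M' a b * w b)" by (rule sum.swap)
    also have "\<dots> = (\<Sum>b<n. w b * (\<Sum>a<n. M' b a * v i a))"
      by (auto simp: sum_distrib_left algebra_simps sym' intro!: sum.cong)
    also have "\<dots> = t * (\<Sum>b<n. v i b * w b)"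
      by (simp add: M'v that sum_distrib_left algebra_simps)
    finally show ?thesis using \<mu> by simp
  qed
  have Mw: "(\<Sum>b<n. M a b * w b) = \<mu> * w a" if "a < n" for a
  proof -
    have "\<mu> * w a = (\<Sum>b<n. M a b * w b) + (\<Sum>b<n. \<Sum>j<k. ((t - l j) * v j a) * (v j b * w b))"
      using ew[OF that] by (simp add: M'_def sum.distrib distrib_right sum_distrib_right mult.assoc)
    also have "(\<Sum>b<n. \<Sum>j<k. ((t - l j) * v j a) * (v j b * w b)) = 0"
      by (subst sum.swap) (simp add: sum_distrib_left[symmetric] orth)
    finally show ?thesis by simp
  qed
  have "orthonormal_eigenpairs n M (Suc k) (v(k := w)) (l(k := \<mu>))"
    unfolding orthonormal_eigenpairs_def
    using on ev orth w1 Mw by (auto simp: less_Suc_eq mult.commute)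
  then show ?thesis by blast
qed

text \<open>The index convention is \<open>v k a\<close> for coordinate \<open>a\<close> of the \<open>k\<close>-th eigenvector.\<close>

definition spectral_decomposition ::
    "nat \<Rightarrow> (nat \<Rightarrow> nat \<Rightarrow> real) \<Rightarrow> (nat \<Rightarrow> nat \<Rightarrow> real) \<Rightarrow> (nat \<Rightarrow> real) \<Rightarrow> bool" where
  "spectral_decomposition n M v l \<longleftrightarrow>
     (\<forall>i<n. \<forall>j<n. (\<Sum>a<n. v i a * v j a) = of_bool (i = j)) \<and>
     (\<forall>a<n. \<forall>b<n. (\<Sum>i<n. v i a * v i b) = of_bool (a = b)) \<and>
     (\<forall>a<n. \<forall>b<n. M a b = (\<Sum>i<n. l i * v i a * v i b))"

lemma orthonormal_rows_imp_columns:
  fixes v :: "nat \<Rightarrow> nat \<Rightarrow> real"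
  assumes on: "\<And>i j. i < n \<Longrightarrow> j < n \<Longrightarrow> (\<Sum>a<n. v i a * v j a) = of_bool (i = j)"
    and "a < n" "b < n"
  shows "(\<Sum>i<n. v i a * v i b) = of_bool (a = b)"
proof -
  define V where "V = mat n n (\<lambda>(i, j). v i j)"
  have V: "V \<in> carrier_mat n n" by (simp add: V_def)
  have VT: "transpose_mat V \<in> carrier_mat n n" using V by simp
  have "V * transpose_mat V = 1\<^sub>m n"
    using on by (intro eq_matI) (auto simp: V_def scalar_prod_def atLeast0LessThan)
  from mat_mult_left_right_inverse[OF V VT this] have "transpose_mat V * V = 1\<^sub>m n" .
  then have "(transpose_mat V * V) $$ (a, b) = 1\<^sub>m n $$ (a, b)" by simp
  then show ?thesis using assms(2,3)
    by (auto simp: V_def scalar_prod_def atLeast0LessThan of_bool_def)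
qed

theorem spectral_decomposition_exists:
  fixes M :: "nat \<Rightarrow> nat \<Rightarrow> real"
  assumes sym: "\<And>i j. i < n \<Longrightarrow> j < n \<Longrightarrow> M i j = M j i"
  shows "\<exists>v l. spectral_decomposition n M v l"
proof -
  have "\<exists>v l. orthonormal_eigenpairs n M k v l" if "k \<le> n" for k
    using that
  proof (induction k)
    case 0
    show ?case by (simp add: orthonormal_eigenpairs_def)
  next
    case (Suc k)
    then obtain v l where "orthonormal_eigenpairs n M k v l" by auto
    from orthonormal_eigenpairs_extend[OF sym this] Suc.prems show ?case by simp
  qed
  from this[of n] obtain v l where "orthonormal_eigenpairs n M n v l" by auto
  then have
    on: "\<And>i j. i < n \<Longrightarrow> j < n \<Longrightarrow> (\<Sum>a<n. v i a * v j a) = of_bool (i = j)" and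
    ev: "\<And>i a. i < n \<Longrightarrow> a < n \<Longrightarrow> (\<Sum>b<n. M a b * v i b) = l i * v i a"
    by (auto simp: orthonormal_eigenpairs_def)
  note cols = orthonormal_rows_imp_columns[of n v, OF on]
  have "M a b = (\<Sum>i<n. l i * v i a * v i b)" if "a < n" "b < n" for a b
  proof -
    have "(\<Sum>i<n. l i * v i a * v i b) = (\<Sum>i<n. \<Sum>c<n. M a c * (v i c * v i b))"
      using ev that by (simp add: ev[symmetric] sum_distrib_right mult.assoc)
    also have "\<dots> = (\<Sum>c<n. M a c * of_bool (c = b))"
      using that by (subst sum.swap) (simp add: sum_distrib_left[symmetric] cols)
    also have "\<dots> = (\<Sum>c<n. if c = b then M a b else 0)" by (intro sum.cong) auto
    also have "\<dots> = M a b" using that by simp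
    finally show ?thesis by simp
  qed
  with on cols have "spectral_decomposition n M v l"
    unfolding spectral_decomposition_def by auto
  then show ?thesis by blast
qed

text \<open>The characteristic polynomial splits into the linear factors of the \<open>l k\<close>, so the order of a root
  counts the indices at which it occurs.\<close>

theorem energy_eq_sum_abs_eigenvalues:
  assumes "spectral_decomposition n M v l"
  shows "energy (mat n n (\<lambda>(i, j). M i j)) = (\<Sum>k<n. \<bar>l k\<bar>)"
proof -
  have on: "\<And>i j. i < n \<Longrightarrow> j < n \<Longrightarrow> (\<Sum>a<n. v i a * v j a) = of_bool (i = j)"
    and co: "\<And>a b. a < n \<Longrightarrow> b < n \<Longrightarrow> (\<Sum>i<n. v i a * v i b) = of_bool (a = b)"
    and M: "\<And>a b. a < n \<Longrightarrow> b < n \<Longrightarrow> M a b = (\<Sum>i<n. l i * v i a * v i b)"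
    using assms by (auto simp: spectral_decomposition_def)
  define A where "A = mat n n (\<lambda>(i, j). M i j)"
  define P where "P = mat n n (\<lambda>(a, i). v i a)"
  define Q where "Q = mat n n (\<lambda>(i, a). v i a)"
  define D where "D = mat n n (\<lambda>(i, j). if i = j then l i else 0)"
  have c: "A \<in> carrier_mat n n" "D \<in> carrier_mat n n" "P \<in> carrier_mat n n" "Q \<in> carrier_mat n n"
    by (auto simp: A_def D_def P_def Q_def)
  have PQ: "P * Q = 1\<^sub>m n" and QP: "Q * P = 1\<^sub>m n"
    using on co by (auto intro!: eq_matI simp: P_def Q_def scalar_prod_def atLeast0LessThan)
  have PD: "P * D = mat n n (\<lambda>(a, i). v i a * l i)"
    by (intro eq_matI)
      (auto simp: P_def D_def scalar_prod_def atLeast0LessThan if_distrib cong: if_cong)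
  have "A = P * D * Q" unfolding PD
    by (intro eq_matI) (auto simp: A_def Q_def M scalar_prod_def atLeast0LessThan algebra_simps)
  with c PQ QP have "similar_mat_wit A D P Q" by (intro similar_mat_witI[of _ _ n]) auto
  then have "similar_mat A D" by (auto simp: similar_mat_def)
  then have "char_poly A = char_poly D" by (rule char_poly_similar)
  also have "\<dots> = (\<Prod>a\<leftarrow>diag_mat D. [:- a, 1:])"
    by (rule char_poly_upper_triangular[OF c(2)]) (auto simp: D_def)
  also have "diag_mat D = map l [0..<n]"
    by (auto simp: diag_mat_def D_def)
  finally have cp: "char_poly A = (\<Prod>k<n. [:- l k, 1:])"
    by (simp add: o_def prod.distinct_set_conv_list[symmetric] atLeast0LessThan)
  have spec: "spectrum A = l ` {..<n}"
    using spectrum_root_char_poly[OF c(1)] by (auto simp: cp poly_prod)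
  have ord: "order x (char_poly A) = card {k\<in>{..<n}. l k = x}" for x
  proof -
    have "order x (\<Prod>k\<in>K. [:- l k, 1:]) = card {k\<in>K. l k = x}" if "finite K" for K
      using that
    proof induction
      case (insert k K)
      have "order x (\<Prod>k\<in>insert k K. [:- l k, 1:])
          = order x [:- l k, 1:] + order x (\<Prod>k\<in>K. [:- l k, 1:])"
        using insert.hyps by (simp add: order_mult del: mult_pCons_left)
      also have "order x [:- l k, 1:] = of_bool (l k = x)"
        using order_power_n_n[of "l k" 1] by (auto intro: order_0I)
      also have "order x (\<Prod>k\<in>K. [:- l k, 1:]) = card {j\<in>K. l j = x}" by (rule insert.IH)
      also have "of_bool (l k = x) + card {j\<in>K. l j = x} = card {j\<in>insert k K. l j = x}"
      proof (cases "l k = x")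
        case True
        then have "{j\<in>insert k K. l j = x} = insert k {j\<in>K. l j = x}" by auto
        then show ?thesis using insert.hyps True by simp
      next
        case False
        then have "{j\<in>insert k K. l j = x} = {j\<in>K. l j = x}" by auto
        then show ?thesis using False by simp
      qed
      finally show ?case .
    qed simp
    then show ?thesis by (simp add: cp)
  qed
  have "energy A = (\<Sum>x\<in>l ` {..<n}. \<Sum>k\<in>{k\<in>{..<n}. l k = x}. \<bar>l k\<bar>)"
    unfolding energy_def spec ord by (intro sum.cong refl) simp
  also have "\<dots> = (\<Sum>k<n. \<bar>l k\<bar>)"
    by (rule sum.image_gen[symmetric]) simp
  finally show ?thesis by (simp add: A_def)
qed

section \<open>Energy as a norm\<close>

text \<open>Matrices are handled as functions on indices below \<open>n\<close>, so that entries can be manipulated as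
  plain finite sums.\<close>

definition fn_energy :: "nat \<Rightarrow> (nat \<Rightarrow> nat \<Rightarrow> real) \<Rightarrow> real" where
  "fn_energy n M = energy (mat n n (\<lambda>(i, j). M i j))"

definition symmetric_fn :: "nat \<Rightarrow> (nat \<Rightarrow> nat \<Rightarrow> real) \<Rightarrow> bool" where
  "symmetric_fn n M \<longleftrightarrow> (\<forall>i<n. \<forall>j<n. M i j = M j i)"

lemma symmetric_fnD: "symmetric_fn n M \<Longrightarrow> i < n \<Longrightarrow> j < n \<Longrightarrow> M i j = M j i"
  by (auto simp: symmetric_fn_def)

lemma spectral_decompositionE:
  assumes "symmetric_fn n M"
  obtains v l where "spectral_decomposition n M v l"
  using spectral_decomposition_exists[of n M] assms by (auto simp: symmetric_fn_def)

lemma parseval: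
  fixes v :: "nat \<Rightarrow> nat \<Rightarrow> real"
  assumes "\<And>a b. a < n \<Longrightarrow> b < n \<Longrightarrow> (\<Sum>i<n. v i a * v i b) = of_bool (a = b)"
  shows "(\<Sum>i<n. (\<Sum>a<n. v i a * x a)\<^sup>2) = (\<Sum>a<n. (x a)\<^sup>2)"
proof -
  have "(\<Sum>i<n. (\<Sum>a<n. v i a * x a)\<^sup>2) = (\<Sum>i<n. \<Sum>a<n. \<Sum>b<n. x a * x b * (v i a * v i b))"
    by (simp add: power2_eq_square sum_product algebra_simps)
  also have "\<dots> = (\<Sum>a<n. \<Sum>b<n. \<Sum>i<n. x a * x b * (v i a * v i b))"
    by (subst sum.swap) (intro sum.cong refl sum.swap)
  also have "\<dots> = (\<Sum>a<n. \<Sum>b<n. if b = a then (x a)\<^sup>2 else 0)"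
    by (intro sum.cong refl) (auto simp: sum_distrib_left[symmetric] assms power2_eq_square)
  also have "\<dots> = (\<Sum>a<n. (x a)\<^sup>2)" by simp
  finally show ?thesis .
qed

context
  fixes n :: nat and M :: "nat \<Rightarrow> nat \<Rightarrow> real" and v l
  assumes sd: "spectral_decomposition n M v l"
begin

lemma eigvecs_rows: "i < n \<Longrightarrow> j < n \<Longrightarrow> (\<Sum>a<n. v i a * v j a) = of_bool (i = j)"
  and eigvecs_cols: "a < n \<Longrightarrow> b < n \<Longrightarrow> (\<Sum>i<n. v i a * v i b) = of_bool (a = b)"
  and eigen_expansion: "a < n \<Longrightarrow> b < n \<Longrightarrow> M a b = (\<Sum>i<n. l i * v i a * v i b)"
  using sd by (auto simp: spectral_decomposition_def)

lemma fn_energy_eq: "fn_energy n M = (\<Sum>k<n. \<bar>l k\<bar>)"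
  unfolding fn_energy_def by (rule energy_eq_sum_abs_eigenvalues[OF sd])

lemma quadratic_form_eq:
  "(\<Sum>a<n. \<Sum>b<n. x a * M a b * x b) = (\<Sum>k<n. l k * (\<Sum>a<n. v k a * x a)\<^sup>2)"
proof -
  have "(\<Sum>a<n. \<Sum>b<n. x a * M a b * x b)
      = (\<Sum>a<n. \<Sum>b<n. \<Sum>k<n. l k * ((v k a * x a) * (v k b * x b)))"
    by (intro sum.cong refl) (simp add: eigen_expansion sum_distrib_left sum_distrib_right algebra_simps)
  also have "\<dots> = (\<Sum>a<n. \<Sum>k<n. \<Sum>b<n. l k * ((v k a * x a) * (v k b * x b)))"
    by (intro sum.cong refl sum.swap)
  also have "\<dots> = (\<Sum>k<n. \<Sum>a<n. \<Sum>b<n. l k * ((v k a * x a) * (v k b * x b)))"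
    by (rule sum.swap)
  also have "\<dots> = (\<Sum>k<n. l k * (\<Sum>a<n. v k a * x a)\<^sup>2)"
    by (simp only: power2_eq_square sum_product) (simp only: sum_distrib_left)
  finally show ?thesis .
qed

lemma eigenvector_eq:
  assumes "k < n" "a < n"
  shows "(\<Sum>b<n. M a b * v k b) = l k * v k a"
proof -
  have "(\<Sum>b<n. M a b * v k b) = (\<Sum>b<n. \<Sum>i<n. (l i * v i a) * (v i b * v k b))"
    using assms by (intro sum.cong refl) (simp add: eigen_expansion sum_distrib_right mult.assoc)
  also have "\<dots> = (\<Sum>i<n. (l i * v i a) * of_bool (i = k))"
    by (subst sum.swap) (simp add: sum_distrib_left[symmetric] eigvecs_rows assms)
  also have "\<dots> = (\<Sum>i<n. if i = k then l k * v k a else 0)" by (intro sum.cong) auto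
  also have "\<dots> = l k * v k a" using assms by simp
  finally show ?thesis .
qed

lemma eigenvalue_eq_quadratic_form:
  assumes "k < n"
  shows "l k = (\<Sum>a<n. \<Sum>b<n. v k a * M a b * v k b)"
proof -
  have "(\<Sum>a<n. \<Sum>b<n. v k a * M a b * v k b) = (\<Sum>a<n. v k a * (\<Sum>b<n. M a b * v k b))"
    by (simp add: sum_distrib_left mult.assoc)
  also have "\<dots> = (\<Sum>a<n. l k * (v k a * v k a))"
    by (intro sum.cong refl) (simp add: eigenvector_eq assms)
  also have "\<dots> = l k" by (simp add: sum_distrib_left[symmetric] eigvecs_rows assms)
  finally show ?thesis ..
qed

lemma sum_eigenvalues_squared: "(\<Sum>k<n. (l k)\<^sup>2) = (\<Sum>a<n. \<Sum>b<n. (M a b)\<^sup>2)"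
proof -
  have "(\<Sum>b<n. (M a b)\<^sup>2) = (\<Sum>k<n. (l k * v k a)\<^sup>2)" if "a < n" for a
  proof -
    have "(\<Sum>k<n. (l k * v k a)\<^sup>2) = (\<Sum>k<n. (\<Sum>b<n. v k b * M a b)\<^sup>2)"
      using that by (intro sum.cong refl) (simp add: eigenvector_eq[symmetric] mult.commute)
    also have "\<dots> = (\<Sum>b<n. (M a b)\<^sup>2)" by (rule parseval[OF eigvecs_cols])
    finally show ?thesis ..
  qed
  then have "(\<Sum>a<n. \<Sum>b<n. (M a b)\<^sup>2) = (\<Sum>a<n. \<Sum>k<n. (l k)\<^sup>2 * (v k a * v k a))"
    by (simp add: power2_eq_square algebra_simps)
  also have "\<dots> = (\<Sum>k<n. (l k)\<^sup>2)"
    by (subst sum.swap) (simp add: sum_distrib_left[symmetric] eigvecs_rows)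
  finally show ?thesis ..
qed

text \<open>With \<open>M = \<Sum>\<^sub>k l\<^sub>k v\<^sub>k v\<^sub>k\<^sup>T\<close>, the weights \<open>\<langle>w\<^sub>i, v\<^sub>k\<rangle>\<^sup>2\<close> of a fixed \<open>k\<close> sum to one over an orthonormal basis
  \<open>w\<close>. Equality holds for the eigenbasis, so the energy is the maximum of these sums over all
  orthonormal bases; subadditivity follows.\<close>

lemma sum_abs_quadratic_forms_le_energy:
  fixes w :: "nat \<Rightarrow> nat \<Rightarrow> real"
  assumes cols: "\<And>a b. a < n \<Longrightarrow> b < n \<Longrightarrow> (\<Sum>i<n. w i a * w i b) = of_bool (a = b)"
  shows "(\<Sum>i<n. \<bar>\<Sum>a<n. \<Sum>b<n. w i a * M a b * w i b\<bar>) \<le> fn_energy n M"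
proof -
  have "(\<Sum>i<n. \<bar>\<Sum>a<n. \<Sum>b<n. w i a * M a b * w i b\<bar>)
      \<le> (\<Sum>i<n. \<Sum>k<n. \<bar>l k\<bar> * (\<Sum>a<n. w i a * v k a)\<^sup>2)"
    unfolding quadratic_form_eq
    by (intro sum_mono order.trans[OF sum_abs]) (simp add: abs_mult mult.commute)
  also have "\<dots> = (\<Sum>k<n. \<bar>l k\<bar> * (\<Sum>i<n. (\<Sum>a<n. w i a * v k a)\<^sup>2))"
    by (subst sum.swap) (simp add: sum_distrib_left)
  also have "\<dots> = (\<Sum>k<n. \<bar>l k\<bar>)"
    using eigvecs_rows by (simp add: parseval[OF cols]) (simp add: power2_eq_square)
  finally show ?thesis by (simp add: fn_energy_eq)
qed

end

text \<open>In an eigenbasis of \<open>A + B\<close> the energy of the sum is \<open>\<Sum>\<^sub>k \<bar>\<langle>v\<^sub>k, A v\<^sub>k\<rangle> + \<langle>v\<^sub>k, B v\<^sub>k\<rangle>\<bar>\<close>, and both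
  parts are controlled by the bound for an arbitrary orthonormal basis.\<close>

lemma fn_energy_triangle:
  assumes "symmetric_fn n A" "symmetric_fn n B"
  shows "fn_energy n (\<lambda>i j. A i j + B i j) \<le> fn_energy n A + fn_energy n B"
proof -
  have "symmetric_fn n (\<lambda>i j. A i j + B i j)" using assms by (simp add: symmetric_fn_def)
  then obtain v l where vl: "spectral_decomposition n (\<lambda>i j. A i j + B i j) v l"
    by (rule spectral_decompositionE)
  obtain va la where a: "spectral_decomposition n A va la" using assms(1) by (rule spectral_decompositionE)
  obtain vb lb where b: "spectral_decomposition n B vb lb" using assms(2) by (rule spectral_decompositionE)
  have "fn_energy n (\<lambda>i j. A i j + B i j)
      = (\<Sum>k<n. \<bar>(\<Sum>a<n. \<Sum>b<n. v k a * A a b * v k b) + (\<Sum>a<n. \<Sum>b<n. v k a * B a b * v k b)\<bar>)"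
    unfolding fn_energy_eq[OF vl]
    by (intro sum.cong refl)
      (simp add: eigenvalue_eq_quadratic_form[OF vl] sum.distrib algebra_simps)
  also have "\<dots> \<le> (\<Sum>k<n. \<bar>\<Sum>a<n. \<Sum>b<n. v k a * A a b * v k b\<bar>
      + \<bar>\<Sum>a<n. \<Sum>b<n. v k a * B a b * v k b\<bar>)"
    by (intro sum_mono abs_triangle_ineq)
  also have "\<dots> = (\<Sum>k<n. \<bar>\<Sum>a<n. \<Sum>b<n. v k a * A a b * v k b\<bar>)
      + (\<Sum>k<n. \<bar>\<Sum>a<n. \<Sum>b<n. v k a * B a b * v k b\<bar>)"
    by (rule sum.distrib)
  also have "\<dots> \<le> fn_energy n A + fn_energy n B"
    by (intro add_mono sum_abs_quadratic_forms_le_energy[OF a] sum_abs_quadratic_forms_le_energy[OF b]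
        eigvecs_cols[OF vl])
  finally show ?thesis .
qed

lemma fn_energy_cmult:
  assumes "symmetric_fn n A"
  shows "fn_energy n (\<lambda>i j. c * A i j) = \<bar>c\<bar> * fn_energy n A"
proof -
  obtain v l where a: "spectral_decomposition n A v l" using assms by (rule spectral_decompositionE)
  then have "spectral_decomposition n (\<lambda>i j. c * A i j) v (\<lambda>k. c * l k)"
    by (simp add: spectral_decomposition_def sum_distrib_left mult.assoc)
  from fn_energy_eq[OF this] fn_energy_eq[OF a] show ?thesis
    by (simp add: abs_mult sum_distrib_left)
qed

lemma fn_energy_cong:
  "(\<And>i j. i < n \<Longrightarrow> j < n \<Longrightarrow> A i j = B i j) \<Longrightarrow> fn_energy n A = fn_energy n B"
  unfolding fn_energy_def by (intro arg_cong[of _ _ energy] eq_matI) auto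

lemma fn_energy_diff_le:
  assumes "symmetric_fn n A" "symmetric_fn n B"
  shows "\<bar>fn_energy n A - fn_energy n B\<bar> \<le> fn_energy n (\<lambda>i j. A i j - B i j)"
proof -
  let ?D = "\<lambda>i j. A i j - B i j"
  have D: "symmetric_fn n ?D" using assms by (simp add: symmetric_fn_def)
  have D': "symmetric_fn n (\<lambda>i j. - 1 * ?D i j)" using assms by (simp add: symmetric_fn_def)
  have "fn_energy n A \<le> fn_energy n B + fn_energy n ?D"
    using fn_energy_triangle[OF assms(2) D] by simp
  moreover have "fn_energy n B \<le> fn_energy n A + fn_energy n ?D"
    using fn_energy_triangle[OF assms(1) D'] fn_energy_cmult[OF D, of "-1"] by simp
  ultimately show ?thesis by linarith
qed

lemma fn_energy_le_frobenius:
  assumes "symmetric_fn n A"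
  shows "fn_energy n A \<le> sqrt (real n * (\<Sum>i<n. \<Sum>j<n. (A i j)\<^sup>2))"
proof -
  obtain v l where a: "spectral_decomposition n A v l" using assms by (rule spectral_decompositionE)
  have "(\<Sum>k<n. \<bar>l k\<bar>)\<^sup>2 \<le> real n * (\<Sum>k<n. (l k)\<^sup>2)"
    using sum_squared_le_sum_of_squares[of "\<lambda>k. \<bar>l k\<bar>" "{..<n}"] by (simp add: mult.commute)
  then show ?thesis
    unfolding fn_energy_eq[OF a] sum_eigenvalues_squared[OF a] by (rule real_le_rsqrt)
qed

text \<open>A constant matrix has rank one, so its energy grows like \<open>n\<close>; the general bound through the
  Frobenius norm would only give \<open>n \<surd>n\<close>, which is too weak for the mean of the degree-distance
  matrix.\<close>

lemma fn_energy_constant_le: "fn_energy n (\<lambda>_ _. c) \<le> \<bar>c\<bar> * real n"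
proof -
  have "symmetric_fn n (\<lambda>_ _. c)" by (simp add: symmetric_fn_def)
  then obtain v l where a: "spectral_decomposition n (\<lambda>_ _. c) v l" by (rule spectral_decompositionE)
  have "l k = c * (\<Sum>a<n. v k a * 1)\<^sup>2" if "k < n" for k
    unfolding eigenvalue_eq_quadratic_form[OF a that]
    by (simp add: power2_eq_square sum_product sum_distrib_left algebra_simps)
  then have "fn_energy n (\<lambda>_ _. c) = \<bar>c\<bar> * (\<Sum>k<n. (\<Sum>a<n. v k a * 1)\<^sup>2)"
    unfolding fn_energy_eq[OF a] by (simp add: abs_mult sum_distrib_left)
  also have "\<dots> = \<bar>c\<bar> * real n" by (subst parseval[OF eigvecs_cols[OF a]]) auto
  finally show ?thesis by simp
qed

section \<open>Resolvent\<close>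

text \<open>A choice of eigenvectors of a symmetric matrix; the resolvent built from it is the inverse of
  \<open>M - i y\<close> and hence independent of the choice.\<close>

definition some_decomposition where
  "some_decomposition n M = (SOME (v, l). spectral_decomposition n M v l)"

definition eigval :: "nat \<Rightarrow> (nat \<Rightarrow> nat \<Rightarrow> real) \<Rightarrow> nat \<Rightarrow> real" where
  "eigval n M = snd (some_decomposition n M)"

definition eigvec :: "nat \<Rightarrow> (nat \<Rightarrow> nat \<Rightarrow> real) \<Rightarrow> nat \<Rightarrow> nat \<Rightarrow> real" where
  "eigvec n M = fst (some_decomposition n M)"

lemma spectral_decomposition_eigval:
  assumes "symmetric_fn n M"
  shows "spectral_decomposition n M (eigvec n M) (eigval n M)"
proof -
  obtain v l where "spectral_decomposition n M v l" using assms by (rule spectral_decompositionE)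
  then have "case (v, l) of (v, l) \<Rightarrow> spectral_decomposition n M v l" by simp
  from someI[of "\<lambda>(v, l). spectral_decomposition n M v l", OF this] show ?thesis
    by (simp add: eigval_def eigvec_def some_decomposition_def split_beta)
qed

text \<open>The inverse of \<open>M - i y\<close> for symmetric \<open>M\<close>, written in the eigenbasis.\<close>

definition resolvent :: "nat \<Rightarrow> (nat \<Rightarrow> nat \<Rightarrow> real) \<Rightarrow> real \<Rightarrow> nat \<Rightarrow> nat \<Rightarrow> complex" where
  "resolvent n M y i j =
     (\<Sum>k<n. of_real (eigvec n M k i) * of_real (eigvec n M k j) / (of_real (eigval n M k) - \<i> * of_real y))"

text \<open>The Stieltjes transform of the empirical eigenvalue distribution at the point \<open>i y\<close>.\<close>

definition stieltjes :: "nat \<Rightarrow> (nat \<Rightarrow> nat \<Rightarrow> real) \<Rightarrow> real \<Rightarrow> complex" where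
  "stieltjes n M y = (\<Sum>i<n. resolvent n M y i i) / of_nat n"

lemma resolvent_sym: "resolvent n M y i j = resolvent n M y j i"
  by (simp add: resolvent_def mult.commute)

context
  fixes n :: nat and M :: "nat \<Rightarrow> nat \<Rightarrow> real" and y :: real
  assumes sym: "symmetric_fn n M" and y: "y > 0"
begin

lemmas decomposition_by_eigvecs = spectral_decomposition_eigval[OF sym]

lemma resolvent_denom_nz: "complex_of_real x - \<i> * of_real y \<noteq> 0"
  using y by (auto simp: complex_eq_iff)

lemma norm_resolvent_denom: "y \<le> cmod (complex_of_real x - \<i> * of_real y)"
  using abs_Im_le_cmod[of "complex_of_real x - \<i> * of_real y"] y by simp

lemma stieltjes_eq: "stieltjes n M y = (\<Sum>k<n. 1 / (of_real (eigval n M k) - \<i> * of_real y)) / of_nat n"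
proof -
  have "(\<Sum>i<n. resolvent n M y i i)
     = (\<Sum>k<n. (of_real (\<Sum>i<n. eigvec n M k i * eigvec n M k i)) / (of_real (eigval n M k) - \<i> * of_real y))"
    unfolding resolvent_def by (subst sum.swap) (simp add: sum_divide_distrib)
  then show ?thesis
    by (simp add: stieltjes_def eigvecs_rows[OF decomposition_by_eigvecs])
qed

text \<open>Row \<open>i\<close> of the resolvent has the coordinates \<open>v\<^sub>k i / (l\<^sub>k - i y)\<close> in the orthonormal eigenbasis,
  and each denominator has modulus at least \<open>y\<close>.\<close>

lemma sum_norm_resolvent_squared_le:
  assumes "i < n"
  shows "(\<Sum>j<n. (cmod (resolvent n M y i j))\<^sup>2) \<le> 1 / y\<^sup>2"
proof -
  define c where "c k = of_real (eigvec n M k i) / (of_real (eigval n M k) - \<i> * of_real y)" for k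
  have Re: "Re (resolvent n M y i j) = (\<Sum>k<n. eigvec n M k j * Re (c k))" for j
    by (simp add: resolvent_def c_def algebra_simps) (simp add: Re_divide algebra_simps)
  have Im: "Im (resolvent n M y i j) = (\<Sum>k<n. eigvec n M k j * Im (c k))" for j
    by (simp add: resolvent_def c_def algebra_simps) (simp add: Im_divide algebra_simps)
  have "(\<Sum>j<n. (cmod (resolvent n M y i j))\<^sup>2) = (\<Sum>k<n. (cmod (c k))\<^sup>2)"
    unfolding cmod_power2 sum.distrib Re Im
    using parseval[of n "\<lambda>j k. eigvec n M k j" "\<lambda>k. Re (c k)", OF eigvecs_rows[OF decomposition_by_eigvecs]]
      parseval[of n "\<lambda>j k. eigvec n M k j" "\<lambda>k. Im (c k)", OF eigvecs_rows[OF decomposition_by_eigvecs]] by simp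
  also have "\<dots> \<le> (\<Sum>k<n. (eigvec n M k i)\<^sup>2 / y\<^sup>2)"
  proof (intro sum_mono)
    fix k assume "k \<in> {..<n}"
    have "y\<^sup>2 \<le> (cmod (of_real (eigval n M k) - \<i> * of_real y))\<^sup>2"
      using y norm_resolvent_denom by (intro power_mono) auto
    moreover have "y\<^sup>2 > 0" using y by simp
    ultimately show "(cmod (c k))\<^sup>2 \<le> (eigvec n M k i)\<^sup>2 / y\<^sup>2"
      unfolding c_def norm_divide power_divide norm_of_real power2_abs
      by (intro divide_left_mono mult_pos_pos) auto
  qed
  also have "\<dots> = 1 / y\<^sup>2"
    using eigvecs_cols[OF decomposition_by_eigvecs assms assms] by (simp add: sum_divide_distrib[symmetric] power2_eq_square)
  finally show ?thesis .
qed

lemma norm_resolvent_le: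
  assumes "i < n" "j < n"
  shows "cmod (resolvent n M y i j) \<le> 1 / y"
proof -
  have "(cmod (resolvent n M y i j))\<^sup>2 \<le> (\<Sum>j<n. (cmod (resolvent n M y i j))\<^sup>2)"
    using assms by (intro member_le_sum) auto
  also have "\<dots> \<le> (1 / y)\<^sup>2" using sum_norm_resolvent_squared_le[OF assms(1)] by (simp add: power_divide)
  finally show ?thesis using y by (meson power2_le_imp_le zero_le_divide_1_iff less_imp_le)
qed

lemma resolvent_right_inverse:
  assumes "a < n" "c < n"
  shows "(\<Sum>b<n. of_real (M a b) * resolvent n M y b c) - \<i> * of_real y * resolvent n M y a c = of_bool (a = c)"
proof -
  let ?d = "\<lambda>k. of_real (eigval n M k) - \<i> * of_real y :: complex"
  have "(\<Sum>b<n. of_real (M a b) * resolvent n M y b c)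
    = (\<Sum>k<n. of_real (\<Sum>b<n. M a b * eigvec n M k b) * (of_real (eigvec n M k c) / ?d k))"
    unfolding resolvent_def sum_distrib_left of_real_sum sum_distrib_right
    by (subst sum.swap) (simp add: algebra_simps)
  also have "\<dots> = (\<Sum>k<n. of_real (eigval n M k) * (of_real (eigvec n M k a) * of_real (eigvec n M k c) / ?d k))"
    by (intro sum.cong refl) (simp add: eigenvector_eq[OF decomposition_by_eigvecs] assms)
  finally have "(\<Sum>b<n. of_real (M a b) * resolvent n M y b c) - \<i> * of_real y * resolvent n M y a c
    = (\<Sum>k<n. ?d k * (of_real (eigvec n M k a) * of_real (eigvec n M k c) / ?d k))"
    unfolding resolvent_def[of n M y a c] sum_distrib_left
    by (simp add: sum_subtractf[symmetric] algebra_simps diff_divide_distrib)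
  also have "\<dots> = of_real (\<Sum>k<n. eigvec n M k a * eigvec n M k c)"
    using resolvent_denom_nz by simp
  also have "\<dots> = of_bool (a = c)" using assms by (simp only: eigvecs_cols[OF decomposition_by_eigvecs] of_bool_def of_real_1 of_real_0 if_distrib[of of_real])
  finally show ?thesis .
qed

lemma resolvent_left_inverse:
  assumes "a < n" "c < n"
  shows "(\<Sum>b<n. resolvent n M y a b * of_real (M b c)) - \<i> * of_real y * resolvent n M y a c = of_bool (a = c)"
proof -
  have "(\<Sum>b<n. resolvent n M y a b * of_real (M b c)) = (\<Sum>b<n. of_real (M c b) * resolvent n M y b a)"
  proof (intro sum.cong refl)
    fix b assume "b \<in> {..<n}"
    then have "M b c = M c b" using symmetric_fnD[OF sym, of b c] assms by simp
    then show "resolvent n M y a b * of_real (M b c) = of_real (M c b) * resolvent n M y b a"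
      by (metis resolvent_sym mult.commute)
  qed
  moreover have "resolvent n M y a c = resolvent n M y c a" by (rule resolvent_sym)
  moreover have "of_bool (a = c) = (of_bool (c = a) :: complex)" by auto
  ultimately show ?thesis using resolvent_right_inverse[OF assms(2,1)] by simp
qed

lemma Im_stieltjes_nonneg: "0 \<le> Im (stieltjes n M y)"
proof -
  have "0 \<le> Im (1 / (complex_of_real x - \<i> * of_real y))" for x
    using y by (simp add: Im_divide divide_nonneg_nonneg)
  then show ?thesis unfolding stieltjes_eq by (simp add: sum_nonneg divide_nonneg_nonneg)
qed

lemma norm_stieltjes_le: "cmod (stieltjes n M y) \<le> 1 / y"
proof (cases "n = 0")
  case False
  have "cmod (\<Sum>i<n. resolvent n M y i i) \<le> (\<Sum>i<n. 1 / y)"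
    by (rule order.trans[OF norm_sum]) (intro sum_mono norm_resolvent_le, auto)
  then show ?thesis using False y by (simp add: stieltjes_def norm_divide field_simps)
qed (use y in \<open>simp add: stieltjes_def\<close>)

text \<open>The right-hand side is the integrand of Coulson's formula for the energy.\<close>

lemma one_minus_y_Im_stieltjes:
  assumes "n > 0"
  shows "1 - y * Im (stieltjes n M y) = (\<Sum>k<n. (eigval n M k)\<^sup>2 / ((eigval n M k)\<^sup>2 + y\<^sup>2)) / real n"
proof -
  have p: "x\<^sup>2 + y\<^sup>2 \<noteq> 0" for x using y by (simp add: sum_power2_eq_zero_iff)
  have "Im (1 / (complex_of_real x - \<i> * of_real y)) = y / (x\<^sup>2 + y\<^sup>2)" for x
    by (simp add: Im_divide)
  then have "y * Im (stieltjes n M y) = (\<Sum>k<n. y\<^sup>2 / ((eigval n M k)\<^sup>2 + y\<^sup>2)) / real n"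
    unfolding stieltjes_eq by (simp add: sum_distrib_left power2_eq_square)
  also have "\<dots> = (\<Sum>k<n. 1 - (eigval n M k)\<^sup>2 / ((eigval n M k)\<^sup>2 + y\<^sup>2)) / real n"
    using p by (intro arg_cong2[of _ _ _ _ "(/)"] sum.cong refl) (simp add: field_simps)
  finally show ?thesis using assms by (simp add: sum_subtractf diff_divide_distrib)
qed

end

text \<open>Insert \<open>G\<^sub>A (B - i y) G\<^sub>B = G\<^sub>A\<close> and \<open>G\<^sub>A (A - i y) G\<^sub>B = G\<^sub>B\<close>.\<close>

lemma resolvent_identity:
  assumes A: "symmetric_fn n A" and B: "symmetric_fn n B" and y: "y > 0" and "p < n" "q < n"
  shows "resolvent n A y p q - resolvent n B y p q
    = (\<Sum>a<n. \<Sum>b<n. resolvent n A y p a * of_real (B a b - A a b) * resolvent n B y b q)"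
proof -
  let ?G = "resolvent n A y" and ?K = "resolvent n B y" and ?z = "\<i> * of_real y :: complex"
  have "(\<Sum>a<n. ?G p a * ((\<Sum>b<n. of_real (B a b) * ?K b q) - ?z * ?K a q))
      = (\<Sum>a<n. if a = q then ?G p q else 0)"
    using resolvent_right_inverse[OF B y] assms by (intro sum.cong refl) auto
  then have 1: "?G p q = (\<Sum>a<n. \<Sum>b<n. ?G p a * of_real (B a b) * ?K b q) - ?z * (\<Sum>a<n. ?G p a * ?K a q)"
    using assms by (simp add: right_diff_distrib sum_subtractf sum_distrib_left algebra_simps)
  have "(\<Sum>b<n. ((\<Sum>a<n. ?G p a * of_real (A a b)) - ?z * ?G p b) * ?K b q)
      = (\<Sum>b<n. if b = p then ?K p q else 0)"
    using resolvent_left_inverse[OF A y] assms by (intro sum.cong refl) auto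
  then have "?K p q = (\<Sum>b<n. \<Sum>a<n. ?G p a * of_real (A a b) * ?K b q) - ?z * (\<Sum>a<n. ?G p a * ?K a q)"
    using assms by (simp add: left_diff_distrib sum_subtractf sum_distrib_right sum_distrib_left mult.assoc)
  also have "(\<Sum>b<n. \<Sum>a<n. ?G p a * of_real (A a b) * ?K b q) = (\<Sum>a<n. \<Sum>b<n. ?G p a * of_real (A a b) * ?K b q)"
    by (rule sum.swap)
  finally have 2: "?K p q = \<dots> - ?z * (\<Sum>a<n. ?G p a * ?K a q)" .
  have "(\<Sum>a<n. \<Sum>b<n. ?G p a * of_real (B a b - A a b) * ?K b q)
      = (\<Sum>a<n. \<Sum>b<n. ?G p a * of_real (B a b) * ?K b q) - (\<Sum>a<n. \<Sum>b<n. ?G p a * of_real (A a b) * ?K b q)"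
    by (simp only: sum_subtractf[symmetric] of_real_diff left_diff_distrib right_diff_distrib)
  then show ?thesis by (simp only: 1 2) simp
qed

lemma resolvent_diff_two_entries:
  assumes A: "symmetric_fn n A" and B: "symmetric_fn n B" and y: "y > 0" and pq: "p < n" "q < n"
    and ij: "i < n" "j < n" "i \<noteq> j"
    and AB: "\<And>a b. a < n \<Longrightarrow> b < n \<Longrightarrow> A a b - B a b = (if {a, b} = {i, j} then h else 0)"
  shows "resolvent n A y p q - resolvent n B y p q
    = - of_real h * (resolvent n A y p i * resolvent n B y j q + resolvent n A y p j * resolvent n B y i q)"
proof -
  let ?G = "resolvent n A y" and ?K = "resolvent n B y"
  have BA: "B a b - A a b = (if a = i then if b = j then - h else 0 else 0) + (if a = j then if b = i then - h else 0 else 0)"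
    if "a < n" "b < n" for a b
    using AB[OF that] ij by (auto simp: doubleton_eq_iff split: if_splits)
  have "resolvent n A y p q - resolvent n B y p q
    = (\<Sum>a<n. \<Sum>b<n. (if a = i then if b = j then - (of_real h * ?G p a * ?K b q) else 0 else 0)
        + (if a = j then if b = i then - (of_real h * ?G p a * ?K b q) else 0 else 0))"
    unfolding resolvent_identity[OF A B y pq]
    by (intro sum.cong refl) (use ij BA in auto)
  also have "\<dots> = (\<Sum>a<n. if a = i then (\<Sum>b<n. if b = j then - (of_real h * ?G p a * ?K b q) else 0) else 0)
     + (\<Sum>a<n. if a = j then (\<Sum>b<n. if b = i then - (of_real h * ?G p a * ?K b q) else 0) else 0)"
    unfolding sum.distrib by (intro arg_cong2[of _ _ _ _ "(+)"] sum.cong) auto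
  also have "\<dots> = - of_real h * (?G p i * ?K j q + ?G p j * ?K i q)"
    using ij by (simp add: algebra_simps)
  finally show ?thesis .
qed

lemma norm_resolvent_diff_le:
  assumes A: "symmetric_fn n A" and B: "symmetric_fn n B" and y: "y > 0" and pq: "p < n" "q < n"
    and ij: "i < n" "j < n" "i \<noteq> j" and h: "h \<ge> 0"
    and AB: "\<And>a b. a < n \<Longrightarrow> b < n \<Longrightarrow> A a b - B a b = (if {a, b} = {i, j} then h else 0)"
  shows "cmod (resolvent n A y p q - resolvent n B y p q) \<le> 2 * h / y\<^sup>2"
proof -
  let ?G = "resolvent n A y" and ?K = "resolvent n B y"
  have "cmod (?G p a * ?K b q) \<le> 1 / y * (1 / y)" if "a < n" "b < n" for a b
    unfolding norm_mult
    using norm_resolvent_le[OF A y pq(1) that(1)] norm_resolvent_le[OF B y that(2) pq(2)] y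
    by (intro mult_mono) auto
  then have "cmod (?G p i * ?K j q + ?G p j * ?K i q) \<le> 1 / y * (1 / y) + 1 / y * (1 / y)"
    using ij by (intro order.trans[OF norm_triangle_ineq] add_mono) auto
  then have "h * cmod (?G p i * ?K j q + ?G p j * ?K i q) \<le> h * (2 / y\<^sup>2)"
    using h by (intro mult_left_mono) (auto simp: power2_eq_square)
  moreover have "cmod (?G p q - ?K p q) = h * cmod (?G p i * ?K j q + ?G p j * ?K i q)"
    using resolvent_diff_two_entries[OF A B y pq ij AB] h by (simp only: norm_mult norm_minus_cancel) simp
  ultimately show ?thesis by (simp add: algebra_simps)
qed

text \<open>The trace of a perturbation in two entries involves only two bilinear sums over rows of the
  resolvents. Each is at most \<open>1 / y\<^sup>2\<close> by the arithmetic-geometric mean inequality and the row bound,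
  so the normalised trace gains the factor \<open>1 / n\<close> that a single entry does not have.\<close>

lemma norm_stieltjes_diff_le:
  assumes A: "symmetric_fn n A" and B: "symmetric_fn n B" and y: "y > 0"
    and ij: "i < n" "j < n" "i \<noteq> j" and h: "h \<ge> 0"
    and AB: "\<And>a b. a < n \<Longrightarrow> b < n \<Longrightarrow> A a b - B a b = (if {a, b} = {i, j} then h else 0)"
  shows "cmod (stieltjes n A y - stieltjes n B y) \<le> 2 * h / (y\<^sup>2 * real n)"
proof -
  let ?G = "resolvent n A y" and ?K = "resolvent n B y"
  have cs: "cmod (\<Sum>m<n. ?G m a * ?K b m) \<le> 1 / y\<^sup>2" if "a < n" "b < n" for a b
  proof -
    have "(\<Sum>m<n. (cmod (?G m a))\<^sup>2) \<le> 1 / y\<^sup>2" "(\<Sum>m<n. (cmod (?K b m))\<^sup>2) \<le> 1 / y\<^sup>2"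
      using sum_norm_resolvent_squared_le[OF A y that(1)] sum_norm_resolvent_squared_le[OF B y that(2)]
      by (simp_all add: resolvent_sym[of n A y _ a])
    moreover have "cmod (?G m a * ?K b m) \<le> ((cmod (?G m a))\<^sup>2 + (cmod (?K b m))\<^sup>2) / 2" for m
      using sum_squares_bound[of "cmod (?G m a)" "cmod (?K b m)"] by (simp add: norm_mult)
    then have "cmod (\<Sum>m<n. ?G m a * ?K b m) \<le> (\<Sum>m<n. ((cmod (?G m a))\<^sup>2 + (cmod (?K b m))\<^sup>2) / 2)"
      by (intro order.trans[OF norm_sum] sum_mono)
    ultimately show ?thesis
      unfolding sum_divide_distrib[symmetric] sum.distrib by simp
  qed
  have "(\<Sum>m<n. ?G m m) - (\<Sum>m<n. ?K m m)
     = - of_real h * ((\<Sum>m<n. ?G m i * ?K j m) + (\<Sum>m<n. ?G m j * ?K i m))"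
    unfolding sum_subtractf[symmetric]
    by (simp add: resolvent_diff_two_entries[OF A B y _ _ ij AB] sum_distrib_left sum_distrib_right
        sum.distrib sum_subtractf sum_negf algebra_simps)
  then have "cmod ((\<Sum>m<n. ?G m m) - (\<Sum>m<n. ?K m m))
      = h * cmod ((\<Sum>m<n. ?G m i * ?K j m) + (\<Sum>m<n. ?G m j * ?K i m))"
    using h by (simp add: norm_mult)
  also have "\<dots> \<le> h * (1 / y\<^sup>2 + 1 / y\<^sup>2)"
    using h cs ij by (intro mult_left_mono order.trans[OF norm_triangle_ineq] add_mono) auto
  finally show ?thesis
    unfolding stieltjes_def diff_divide_distrib[symmetric] norm_divide
    using ij by (simp add: field_simps)
qed

section \<open>Independent Bernoulli variables\<close>

text \<open>The distribution of the edge indicators of the random graph; \<open>expect\<close> is its expectation. For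
  finitely many edges the support is finite, so every function is integrable and the usual rules
  hold without side conditions.\<close>

definition coin_pmf :: "'e set \<Rightarrow> real \<Rightarrow> ('e \<Rightarrow> bool) pmf" where
  "coin_pmf A p = Pi_pmf A False (\<lambda>_. bernoulli_pmf p)"

definition expect :: "'e set \<Rightarrow> real \<Rightarrow> (('e \<Rightarrow> bool) \<Rightarrow> 'b) \<Rightarrow> 'b :: {banach, second_countable_topology}" where
  "expect A p f = integral\<^sup>L (measure_pmf (coin_pmf A p)) f"

context
  fixes A :: "'e set" and p :: real
  assumes A: "finite A" and p: "0 \<le> p" "p \<le> 1"
begin

lemma finite_set_coin_pmf: "finite (set_pmf (coin_pmf A p))"
  unfolding coin_pmf_def
  by (rule finite_subset[OF set_Pi_pmf_subset'[OF A]]) (intro finite_PiE_dflt A, auto)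

lemma expect_eq_sum:
  "expect A p f = (\<Sum>\<xi>\<in>set_pmf (coin_pmf A p). pmf (coin_pmf A p) \<xi> *\<^sub>R f \<xi>)"
  unfolding expect_def by (rule integral_measure_pmf[OF finite_set_coin_pmf]) (simp add: set_pmf_eq)

lemma expect_add: "expect A p (\<lambda>\<xi>. f \<xi> + g \<xi>) = expect A p f + expect A p g"
  by (simp add: expect_eq_sum scaleR_add_right sum.distrib)

lemma expect_diff: "expect A p (\<lambda>\<xi>. f \<xi> - g \<xi>) = expect A p f - expect A p g"
  by (simp add: expect_eq_sum scaleR_diff_right sum_subtractf)

lemma expect_minus: "expect A p (\<lambda>\<xi>. - f \<xi>) = - expect A p f"
  by (simp add: expect_eq_sum sum_negf)

lemma expect_sum: "expect A p (\<lambda>\<xi>. \<Sum>i\<in>I. f i \<xi>) = (\<Sum>i\<in>I. expect A p (f i))"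
  by (simp add: expect_eq_sum scaleR_sum_right) (rule sum.swap)

lemma expect_cmult: "expect A p (\<lambda>\<xi>. c * f \<xi>) = c * expect A p f"
  for c :: "'b :: {banach, second_countable_topology, real_normed_algebra}"
  by (simp add: expect_eq_sum sum_distrib_left)

lemma expect_const: "expect A p (\<lambda>_. c) = c"
  by (simp add: expect_def)

lemma expect_mono:
  fixes f g :: "_ \<Rightarrow> real"
  shows "(\<And>\<xi>. f \<xi> \<le> g \<xi>) \<Longrightarrow> expect A p f \<le> expect A p g"
  by (simp add: expect_eq_sum sum_mono mult_left_mono)

lemma expect_nonneg:
  fixes f :: "_ \<Rightarrow> real"
  shows "(\<And>\<xi>. 0 \<le> f \<xi>) \<Longrightarrow> 0 \<le> expect A p f"
  using expect_mono[of "\<lambda>_. 0" f] by (simp add: expect_const)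

lemma norm_expect_le: "norm (expect A p f) \<le> expect A p (\<lambda>\<xi>. norm (f \<xi>))"
  unfolding expect_def by (rule integral_norm_bound)

lemma expect_of_real: "expect A p (\<lambda>\<xi>. complex_of_real (f \<xi>)) = of_real (expect A p f)"
  by (simp add: expect_eq_sum scaleR_conv_of_real)

lemma expect_le_sqrt:
  fixes f :: "_ \<Rightarrow> real"
  shows "expect A p f \<le> sqrt (expect A p (\<lambda>\<xi>. (f \<xi>)\<^sup>2))"
proof (rule real_le_rsqrt)
  define m where "m = expect A p f"
  have "0 \<le> expect A p (\<lambda>\<xi>. (f \<xi> - m)\<^sup>2)" by (rule expect_nonneg) simp
  also have "(\<lambda>\<xi>. (f \<xi> - m)\<^sup>2) = (\<lambda>\<xi>. ((f \<xi>)\<^sup>2 - (2 * m) * f \<xi>) + m\<^sup>2)"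
    by (auto simp: power2_eq_square algebra_simps)
  also have "expect A p \<dots> = expect A p (\<lambda>\<xi>. (f \<xi>)\<^sup>2) - m\<^sup>2"
    by (simp only: expect_add expect_diff expect_cmult expect_const m_def[symmetric])
      (simp add: power2_eq_square)
  finally show "(expect A p f)\<^sup>2 \<le> expect A p (\<lambda>\<xi>. (f \<xi>)\<^sup>2)" by (simp add: m_def)
qed

lemma prob_coin_eq_expect:
  "measure_pmf.prob (coin_pmf A p) S = expect A p (\<lambda>\<xi>. of_bool (\<xi> \<in> S) :: real)"
proof -
  have "(\<lambda>\<xi>. of_bool (\<xi> \<in> S) :: real) = indicator S" by (auto simp: indicator_def)
  then show ?thesis by (simp add: expect_def)
qed

lemma prob_coin_markov:
  fixes Y :: "_ \<Rightarrow> real"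
  assumes "\<And>\<xi>. Y \<xi> \<ge> 0" "\<epsilon> > 0"
  shows "measure_pmf.prob (coin_pmf A p) {\<xi>. Y \<xi> > \<epsilon>} \<le> expect A p Y / \<epsilon>"
proof -
  have "of_bool (Y \<xi> > \<epsilon>) \<le> inverse \<epsilon> * Y \<xi>" for \<xi>
    using assms by (auto simp: field_simps)
  then have "expect A p (\<lambda>\<xi>. of_bool (Y \<xi> > \<epsilon>)) \<le> expect A p (\<lambda>\<xi>. inverse \<epsilon> * Y \<xi>)"
    by (intro expect_mono)
  then show ?thesis
    by (simp add: prob_coin_eq_expect expect_cmult divide_inverse mult.commute)
qed

text \<open>Conditioning on a single coin: the updated functions depend on the remaining coins only.\<close>

lemma expect_condition:
  fixes f :: "_ \<Rightarrow> 'b :: {banach, second_countable_topology}"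
  assumes e: "e \<in> A"
  shows "expect A p f
    = p *\<^sub>R expect A p (\<lambda>\<xi>. f (\<xi>(e := True))) + (1 - p) *\<^sub>R expect A p (\<lambda>\<xi>. f (\<xi>(e := False)))"
proof -
  let ?Q = "coin_pmf (A - {e}) p"
  have fin: "finite (set_pmf ?Q)"
    unfolding coin_pmf_def
    by (rule finite_subset[OF set_Pi_pmf_subset']) (use A in \<open>auto intro!: finite_PiE_dflt\<close>)
  have "coin_pmf A p = bernoulli_pmf p \<bind> (\<lambda>y. map_pmf (\<lambda>f. f(e := y)) ?Q)"
    unfolding coin_pmf_def using Pi_pmf_insert'[of "A - {e}" e False "\<lambda>_. bernoulli_pmf p"] A e
    by (simp add: insert_absorb map_pmf_def)
  then have *: "expect A p g
      = p *\<^sub>R integral\<^sup>L ?Q (\<lambda>\<xi>. g (\<xi>(e := True))) + (1 - p) *\<^sub>R integral\<^sup>L ?Q (\<lambda>\<xi>. g (\<xi>(e := False)))"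
    for g :: "_ \<Rightarrow> 'b"
    unfolding expect_def \<open>coin_pmf A p = _\<close> using fin p
    by (subst pmf_expectation_bind[where A = UNIV]) (auto simp: UNIV_bool)
  have **: "p *\<^sub>R x + (1 - p) *\<^sub>R x = x" for x :: 'b
    by (simp add: scaleR_add_left[symmetric])
  show ?thesis
    by (simp add: *[of f] *[of "\<lambda>\<xi>. f (\<xi>(e := True))"] *[of "\<lambda>\<xi>. f (\<xi>(e := False))"] **)
qed

lemma expect_edge:
  fixes f :: "_ \<Rightarrow> 'b :: {banach, second_countable_topology, real_normed_algebra_1}"
  assumes e: "e \<in> A"
  shows "expect A p (\<lambda>\<xi>. of_bool (\<xi> e) * f \<xi>) = p *\<^sub>R expect A p (\<lambda>\<xi>. f (\<xi>(e := True)))"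
  by (subst expect_condition[OF e]) (simp add: expect_const)

text \<open>Integration by parts for a Bernoulli variable. The identity is exact, without the remainder that
  a Taylor expansion would leave for a general distribution.\<close>

lemma expect_centred:
  fixes f :: "_ \<Rightarrow> complex"
  assumes e: "e \<in> A"
  shows "expect A p (\<lambda>\<xi>. of_real (of_bool (\<xi> e) - p) * f \<xi>)
     = of_real (p * (1 - p)) * expect A p (\<lambda>\<xi>. f (\<xi>(e := True)) - f (\<xi>(e := False)))"
  by (subst expect_condition[OF e])
    (simp add: expect_cmult expect_diff expect_minus scaleR_conv_of_real algebra_simps)

lemma expect_centred_real:
  fixes f :: "_ \<Rightarrow> real"
  assumes e: "e \<in> A"
  shows "expect A p (\<lambda>\<xi>. (of_bool (\<xi> e) - p) * f \<xi>)
     = p * (1 - p) * expect A p (\<lambda>\<xi>. f (\<xi>(e := True)) - f (\<xi>(e := False)))"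
  by (subst expect_condition[OF e])
    (simp add: expect_cmult expect_diff expect_minus algebra_simps)

end

section \<open>The centred adjacency matrix\<close>

text \<open>The centred adjacency matrix, scaled so that each row has squared norm of order one.\<close>

definition wigner :: "nat \<Rightarrow> real \<Rightarrow> (nat set \<Rightarrow> bool) \<Rightarrow> nat \<Rightarrow> nat \<Rightarrow> real" where
  "wigner n p \<xi> i j = (if i = j then 0 else (of_bool (\<xi> {i, j}) - p) / sqrt (real n))"

lemma finite_all_edges: "finite (all_edges n)"
  by (rule finite_subset[of _ "Pow {..<n}"]) (auto simp: all_edges_def)

lemma edge_in_all_edges: "i < n \<Longrightarrow> j < n \<Longrightarrow> i \<noteq> j \<Longrightarrow> {i, j} \<in> all_edges n"
  by (auto simp: all_edges_def)

lemma symmetric_wigner: "symmetric_fn n (wigner n p \<xi>)"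
  by (auto simp: symmetric_fn_def wigner_def insert_commute)

lemma wigner_flip:
  assumes "a < n" "b < n" "i \<noteq> j"
  shows "wigner n p (\<xi>({i, j} := True)) a b - wigner n p (\<xi>({i, j} := False)) a b
     = (if {a, b} = {i, j} then 1 / sqrt (real n) else 0)"
proof -
  have "{a, b} \<noteq> {i, j}" if "a = b" using that assms by auto
  then show ?thesis by (auto simp: wigner_def diff_divide_distrib)
qed

text \<open>The Stieltjes transform \<open>s\<close> of the semicircle law with variance \<open>p (1 - p)\<close> satisfies
  \<open>1 + z s + p (1 - p) s\<^sup>2 = 0\<close>; this is the left-hand side for the random matrix at \<open>z = i y\<close>.\<close>

definition equation_defect :: "nat \<Rightarrow> real \<Rightarrow> real \<Rightarrow> (nat set \<Rightarrow> bool) \<Rightarrow> complex" where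
  "equation_defect n p y \<xi> = 1 + \<i> * of_real y * stieltjes n (wigner n p \<xi>) y
     + of_real (p * (1 - p)) * (stieltjes n (wigner n p \<xi>) y)\<^sup>2"

context
  fixes n :: nat and p y :: real
  assumes n: "n > 0" and p: "0 < p" "p < 1" and y: "y > 0"
begin

private abbreviation (input) "G \<xi> \<equiv> resolvent n (wigner n p \<xi>) y"
private abbreviation (input) "s \<xi> \<equiv> stieltjes n (wigner n p \<xi>) y"
private abbreviation (input) "F \<equiv> equation_defect n p y"
private abbreviation (input) "EE \<equiv> expect (all_edges n) p"
private abbreviation (input) "\<sigma>2 \<equiv> p * (1 - p)"
private abbreviation (input) "h \<equiv> 1 / sqrt (real n)"

private lemma h: "h \<ge> 0" "h \<le> 1" "real n * (h * h) = 1" "h / real n \<le> h"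
  using n by (auto simp: field_simps real_le_lsqrt)

private lemma var: "0 < \<sigma>2" "\<sigma>2 \<le> 1"
  using p by (auto simp: mult_le_one)

private lemma G_le: "i < n \<Longrightarrow> j < n \<Longrightarrow> cmod (G \<xi> i j) \<le> 1 / y"
  by (rule norm_resolvent_le[OF symmetric_wigner y])

private lemma s_le: "cmod (s \<xi>) \<le> 1 / y"
  by (rule norm_stieltjes_le[OF symmetric_wigner y])

private lemma F_le: "cmod (F \<xi>) \<le> 2 + 1 / y\<^sup>2"
proof -
  have "cmod (\<i> * of_real y * s \<xi>) \<le> 1"
    using s_le[of \<xi>] y by (simp add: norm_mult field_simps)
  moreover have "cmod (of_real \<sigma>2 * (s \<xi>)\<^sup>2) \<le> 1 * (1 / y)\<^sup>2"
    unfolding norm_mult norm_power norm_of_real using s_le[of \<xi>] var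
    by (intro mult_mono power_mono) auto
  ultimately show ?thesis unfolding equation_defect_def
    using norm_triangle_ineq[of "1 + \<i> * of_real y * s \<xi>" "of_real \<sigma>2 * (s \<xi>)\<^sup>2"]
      norm_triangle_ineq[of 1 "\<i> * of_real y * s \<xi>"] by (simp add: power_divide)
qed

private lemma flip_G:
  assumes "i < n" "j < n" "i \<noteq> j" "a < n" "b < n"
  shows "cmod (G (\<xi>({i, j} := True)) a b - G (\<xi>({i, j} := False)) a b) \<le> 2 * h / y\<^sup>2"
  by (rule norm_resolvent_diff_le[OF symmetric_wigner symmetric_wigner y assms(4,5) assms(1-3) h(1)])
    (simp add: wigner_flip assms)

private lemma flip_s:
  assumes "i < n" "j < n" "i \<noteq> j"
  shows "cmod (s (\<xi>({i, j} := True)) - s (\<xi>({i, j} := False))) \<le> 2 * h / (y\<^sup>2 * real n)"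
  by (rule norm_stieltjes_diff_le[OF symmetric_wigner symmetric_wigner y assms(1-3) h(1)])
    (simp add: wigner_flip assms)

text \<open>The factor \<open>y + 2 / y\<close> bounds the divided difference of the quadratic polynomial in \<open>s\<close>, and
  \<open>2 / y\<^sup>2\<close> is the sensitivity of \<open>s\<close> to one edge in units of \<open>1 / (n \<surd>n)\<close>.\<close>

private definition "c \<equiv> (y + 2 / y) * (2 / y\<^sup>2)"

private lemma c_nonneg: "c \<ge> 0" using y by (simp add: c_def)

text \<open>The defect is a polynomial in the bounded quantity \<open>s\<close>, so it inherits from \<open>s\<close> a sensitivity to
  one edge of order \<open>1 / (n \<surd>n)\<close>.\<close>

private lemma flip_F:
  assumes "i < n" "j < n" "i \<noteq> j"
  shows "cmod (F (\<xi>({i, j} := True)) - F (\<xi>({i, j} := False))) \<le> c * (h / real n)"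
proof -
  let ?a = "s (\<xi>({i, j} := True))" and ?b = "s (\<xi>({i, j} := False))"
  have "F (\<xi>({i, j} := True)) - F (\<xi>({i, j} := False)) = (\<i> * of_real y + of_real \<sigma>2 * (?a + ?b)) * (?a - ?b)"
    by (simp add: equation_defect_def power2_eq_square algebra_simps)
  moreover have "cmod (\<i> * of_real y + of_real \<sigma>2 * (?a + ?b)) \<le> y + 1 * (2 / y)"
  proof -
    have "cmod (?a + ?b) \<le> 2 / y"
      using norm_triangle_ineq[of ?a ?b] s_le[of "\<xi>({i, j} := True)"] s_le[of "\<xi>({i, j} := False)"] by simp
    then have "\<sigma>2 * cmod (?a + ?b) \<le> 1 * (2 / y)" using var by (intro mult_mono) auto
    then show ?thesis
      using norm_triangle_ineq[of "\<i> * of_real y" "of_real \<sigma>2 * (?a + ?b)"] y var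
      by (simp add: norm_mult del: of_real_mult)
  qed
  ultimately have "cmod (F (\<xi>({i, j} := True)) - F (\<xi>({i, j} := False))) \<le> (y + 2 / y) * (2 * h / (y\<^sup>2 * real n))"
    unfolding norm_mult using flip_s[OF assms] y by (simp only: norm_mult) (intro mult_mono, auto)
  also have "\<dots> = c * (h / real n)" by (simp add: c_def)
  finally show ?thesis .
qed

text \<open>One of the two updates does nothing, so the distance to the current outcome is either zero or the
  distance between the two updates.\<close>

private lemma norm_update_diff_le:
  fixes f :: "_ \<Rightarrow> complex"
  assumes "\<And>\<xi>. cmod (f (\<xi>(e := True)) - f (\<xi>(e := False))) \<le> d"
  shows "cmod (f (\<xi>(e := b)) - f \<xi>) \<le> d"
proof -
  have d: "d \<ge> 0" using assms[of \<xi>] norm_ge_zero order.trans by blast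
  have "\<xi> = \<xi>(e := \<xi> e)" by simp
  then have "cmod (f (\<xi>(e := b)) - f \<xi>) = cmod (f (\<xi>(e := b)) - f (\<xi>(e := \<xi> e)))" by simp
  also have "\<dots> \<le> d"
    using assms[of \<xi>] d by (cases b; cases "\<xi> e") (simp_all add: norm_minus_commute)
  finally show ?thesis .
qed

private definition "K \<equiv> (2 + 1 / y\<^sup>2) * (4 / y ^ 3) + c / y\<^sup>2 + c / y"

text \<open>The first summand is what integration by parts turns the contribution of the edge \<open>{i, j}\<close> into,
  tested against the conjugate of the defect. The resolvent identity produces
  \<open>- G j j G i i\<close> from it, with the two factors taken at the two values of the edge; this cancels the second
  summand up to errors of order \<open>1 / \<surd>n\<close>. The remaining product \<open>G j i G j i\<close> is
  controlled only on average over all pairs, so the bound keeps one factor.\<close>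

lemma pair_term_bound:
  assumes ij: "i < n" "j < n" "i \<noteq> j"
  defines "t \<equiv> \<lambda>\<xi>. \<xi>({i, j} := True)" and "f \<equiv> \<lambda>\<xi>. \<xi>({i, j} := False)"
  shows "cmod (of_real (real n * h) * (G (t \<xi>) j i * cnj (F (t \<xi>)) - G (f \<xi>) j i * cnj (F (f \<xi>)))
      + G \<xi> i i * G \<xi> j j * cnj (F \<xi>))
    \<le> (2 + 1 / y\<^sup>2) / y * cmod (G \<xi> j i) + K * h"
proof -
  define B where "B = 2 + 1 / y\<^sup>2"
  have B0: "B \<ge> 0" by (simp add: B_def)
  have FB: "cmod (cnj (F \<xi>)) \<le> B" for \<xi> using F_le by (simp add: B_def)
  (* One edge changes two entries of W by h, hence two terms. *)
  have dG: "G (t \<xi>) j i - G (f \<xi>) j i = - of_real h * (G (t \<xi>) j i * G (f \<xi>) j i + G (t \<xi>) j j * G (f \<xi>) i i)"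
    unfolding t_def f_def
    by (rule resolvent_diff_two_entries[OF symmetric_wigner symmetric_wigner y ij(2,1) ij])
      (simp add: wigner_flip ij)
  (* The weight n h of the pair meets the factor h of the resolvent identity: n h h = 1. *)
  have nhh: "of_real (real n * h) * of_real h = (1 :: complex)"
    using h(3) by (metis mult.assoc of_real_1 of_real_mult)
  define T1 where "T1 = G (t \<xi>) j i * G (f \<xi>) j i * cnj (F (t \<xi>))"
  define T2 where "T2 = of_real (real n * h) * (G (f \<xi>) j i * (cnj (F (t \<xi>)) - cnj (F (f \<xi>))))"
  define T3 where "T3 = G \<xi> i i * G \<xi> j j * cnj (F \<xi>) - G (t \<xi>) j j * G (f \<xi>) i i * cnj (F (t \<xi>))"
  have "of_real (real n * h) * (G (t \<xi>) j i * cnj (F (t \<xi>)) - G (f \<xi>) j i * cnj (F (f \<xi>)))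
      = of_real (real n * h) * ((G (t \<xi>) j i - G (f \<xi>) j i) * cnj (F (t \<xi>))) + T2"
    by (simp add: T2_def algebra_simps)
  also have "of_real (real n * h) * ((G (t \<xi>) j i - G (f \<xi>) j i) * cnj (F (t \<xi>)))
      = - (of_real (real n * h) * of_real h) * ((G (t \<xi>) j i * G (f \<xi>) j i + G (t \<xi>) j j * G (f \<xi>) i i) * cnj (F (t \<xi>)))"
    unfolding dG by (simp only: mult.assoc mult_minus_left mult_minus_right)
  finally have eq: "of_real (real n * h) * (G (t \<xi>) j i * cnj (F (t \<xi>)) - G (f \<xi>) j i * cnj (F (f \<xi>)))
      + G \<xi> i i * G \<xi> j j * cnj (F \<xi>) = - T1 + T2 + T3"
    unfolding nhh T1_def T3_def by (simp add: algebra_simps)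
  have 1: "cmod T1 \<le> B / y * cmod (G \<xi> j i)"
  proof -
    (* Either t or f leaves the outcome unchanged, so one factor is the current entry. *)
    have "cmod (G (t \<xi>) j i * G (f \<xi>) j i) \<le> 1 / y * cmod (G \<xi> j i)"
    proof (cases "\<xi> {i, j}")
      case True
      then have "t \<xi> = \<xi>" by (simp add: t_def fun_upd_idem)
      then show ?thesis using G_le[OF ij(2,1), of "f \<xi>"]
        by (simp only: norm_mult mult.commute[of "cmod (G \<xi> j i)"]) (intro mult_right_mono, auto)
    next
      case False
      then have "f \<xi> = \<xi>" by (simp add: f_def fun_upd_idem)
      then show ?thesis using G_le[OF ij(2,1), of "t \<xi>"]
        by (simp only: norm_mult) (intro mult_right_mono, auto)
    qed
    then have "cmod T1 \<le> (1 / y * cmod (G \<xi> j i)) * B"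
      unfolding T1_def norm_mult[of "_ * _" "cnj _"] using FB y by (intro mult_mono) auto
    then show ?thesis by (simp add: algebra_simps)
  qed
  have dF: "cmod (cnj (F (t \<xi>)) - cnj (F (f \<xi>))) \<le> c * (h / real n)"
    using flip_F[OF ij, of \<xi>] by (simp add: t_def f_def complex_cnj_diff[symmetric] del: complex_cnj_diff)
  have 2: "cmod T2 \<le> c / y * h"
  proof -
    have "cmod T2 \<le> real n * h * (1 / y * (c * (h / real n)))"
      unfolding T2_def norm_mult norm_of_real using h G_le[OF ij(2,1), of "f \<xi>"] dF y
      by (intro mult_mono) auto
    also have "\<dots> = c / y * (h * h)" using n by simp
    also have "\<dots> \<le> c / y * h" using h c_nonneg y by (intro mult_left_mono mult_left_le) auto
    finally show ?thesis .
  qed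
  have gt: "cmod (G (t \<xi>) a b - G \<xi> a b) \<le> 2 * h / y\<^sup>2" if "a < n" "b < n" for a b
    unfolding t_def by (rule norm_update_diff_le[of "\<lambda>\<xi>. G \<xi> a b"]) (rule flip_G[OF ij that])
  have gf: "cmod (G (f \<xi>) a b - G \<xi> a b) \<le> 2 * h / y\<^sup>2" if "a < n" "b < n" for a b
    unfolding f_def by (rule norm_update_diff_le[of "\<lambda>\<xi>. G \<xi> a b"]) (rule flip_G[OF ij that])
  have dF': "cmod (cnj (F (t \<xi>)) - cnj (F \<xi>)) \<le> c * h"
  proof -
    have "cmod (F (t \<xi>) - F \<xi>) \<le> c * (h / real n)"
      unfolding t_def by (rule norm_update_diff_le) (rule flip_F[OF ij])
    also have "\<dots> \<le> c * h" using h(4) c_nonneg by (intro mult_left_mono) auto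
    finally show ?thesis by (simp add: complex_cnj_diff[symmetric] del: complex_cnj_diff)
  qed
  have 3: "cmod T3 \<le> B * (4 * h / y ^ 3) + c / y\<^sup>2 * h"
  proof -
    have "T3 = - ((G (t \<xi>) j j - G \<xi> j j) * G (f \<xi>) i i * cnj (F (t \<xi>))
       + G \<xi> j j * (G (f \<xi>) i i - G \<xi> i i) * cnj (F (t \<xi>))
       + G \<xi> j j * G \<xi> i i * (cnj (F (t \<xi>)) - cnj (F \<xi>)))"
      unfolding T3_def by (simp add: algebra_simps)
    then have "cmod T3 \<le> cmod ((G (t \<xi>) j j - G \<xi> j j) * G (f \<xi>) i i * cnj (F (t \<xi>)))
       + cmod (G \<xi> j j * (G (f \<xi>) i i - G \<xi> i i) * cnj (F (t \<xi>)))
       + cmod (G \<xi> j j * G \<xi> i i * (cnj (F (t \<xi>)) - cnj (F \<xi>)))"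
      by (simp only: norm_minus_cancel) (intro order.trans[OF norm_triangle_ineq] add_right_mono norm_triangle_ineq)
    also have "\<dots> \<le> (2 * h / y\<^sup>2) * (1 / y) * B + (1 / y) * (2 * h / y\<^sup>2) * B + (1 / y) * (1 / y) * (c * h)"
      unfolding norm_mult using y h ij B0 c_nonneg
      by (intro add_mono mult_mono gt gf G_le FB dF') auto
    also have "\<dots> = B * (4 * h / y ^ 3) + c / y\<^sup>2 * h"
      using y by (simp add: field_simps power2_eq_square power3_eq_cube)
    finally show ?thesis .
  qed
  have "cmod (- T1 + T2 + T3) \<le> cmod T1 + cmod T2 + cmod T3"
    using norm_triangle_ineq[of "- T1 + T2" T3] norm_triangle_ineq[of "- T1" T2] by simp
  also have "\<dots> \<le> B / y * cmod (G \<xi> j i) + c / y * h + (B * (4 * h / y ^ 3) + c / y\<^sup>2 * h)"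
    by (intro add_mono 1 2 3)
  also have "\<dots> = B / y * cmod (G \<xi> j i) + K * h"
  proof -
    have "K = B * (4 / y ^ 3) + c / y\<^sup>2 + c / y" by (simp add: K_def B_def)
    then show ?thesis by (simp add: algebra_simps)
  qed
  finally show ?thesis unfolding eq B_def .
qed

text \<open>The trace of \<open>(W - i y) G = 1\<close>.\<close>

lemma resolvent_trace_equation:
  "of_nat n * (1 + \<i> * of_real y * s \<xi>)
    = (\<Sum>i<n. \<Sum>j<n. of_real (wigner n p \<xi> i j) * G \<xi> j i)"
proof -
  have "(\<Sum>i<n. (\<Sum>j<n. of_real (wigner n p \<xi> i j) * G \<xi> j i) - \<i> * of_real y * G \<xi> i i) = (\<Sum>i<n. 1)"
    by (intro sum.cong refl) (simp add: resolvent_right_inverse[OF symmetric_wigner y])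
  moreover have "(\<Sum>i<n. G \<xi> i i) = of_nat n * s \<xi>" using n by (simp add: stieltjes_def)
  ultimately show ?thesis
    by (simp add: sum_subtractf sum_distrib_left[symmetric] algebra_simps)
qed

lemma sum_norm_row_le:
  assumes "j < n"
  shows "(\<Sum>i<n. cmod (G \<xi> j i)) \<le> real n * h / y"
proof -
  have "(\<Sum>i<n. cmod (G \<xi> j i))\<^sup>2 \<le> real n * (\<Sum>i<n. (cmod (G \<xi> j i))\<^sup>2)"
    using sum_squared_le_sum_of_squares[of "\<lambda>i. cmod (G \<xi> j i)" "{..<n}"] by (simp add: mult.commute)
  also have "\<dots> \<le> real n * (1 / y\<^sup>2)"
    by (intro mult_left_mono sum_norm_resolvent_squared_le[OF symmetric_wigner y assms]) auto
  also have "\<dots> = (sqrt (real n) / y)\<^sup>2" by (simp add: power_divide)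
  finally have "(\<Sum>i<n. cmod (G \<xi> j i)) \<le> sqrt (real n) / y"
    by (rule power2_le_imp_le) (use y in simp)
  also have "sqrt (real n) = real n * h" using n by (simp add: real_div_sqrt)
  finally show ?thesis .
qed

text \<open>Write \<open>\<bar>F\<bar>\<^sup>2 = F cnj F\<close>, expand the first factor by the trace equation, and integrate by parts in each
  edge variable. Treating \<open>cnj F\<close> as part of the function that is differentiated costs only another
  error of order \<open>1 / \<surd>n\<close>, and it yields the second moment at once.\<close>

lemma expect_defect_squared_le:
  "EE (\<lambda>\<xi>. (cmod (F \<xi>))\<^sup>2) \<le> ((2 + 1 / y\<^sup>2) / y\<^sup>2 + K + (2 + 1 / y\<^sup>2) / y\<^sup>2) * h"
proof -
  note fin = finite_all_edges[of n]
  have p': "0 \<le> p" "p \<le> 1" using p by auto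
  note ex = expect_add[OF fin p'] expect_sum[OF fin p'] expect_cmult[OF fin p']
  define B where "B = 2 + 1 / y\<^sup>2"
  have B0: "B \<ge> 0" by (simp add: B_def)
  (* P arises from the trace equation, Q from the square of s; the two nearly cancel off the diagonal. *)
  define P where "P i j \<xi> = (if i = j then 0 else
      of_real (real n * h) * (G (\<xi>({i, j} := True)) j i * cnj (F (\<xi>({i, j} := True)))
         - G (\<xi>({i, j} := False)) j i * cnj (F (\<xi>({i, j} := False)))))" for i j \<xi>
  define Q where "Q i j \<xi> = G \<xi> i i * G \<xi> j j * cnj (F \<xi>)" for i j \<xi>
  have FF: "of_nat n * of_nat n * (F \<xi> * cnj (F \<xi>))
      = (\<Sum>i<n. \<Sum>j<n. of_nat n * (of_real (wigner n p \<xi> i j) * (G \<xi> j i * cnj (F \<xi>))))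
        + of_real \<sigma>2 * (\<Sum>i<n. \<Sum>j<n. Q i j \<xi>)" for \<xi>
  proof -
    have ns: "of_nat n * s \<xi> = (\<Sum>i<n. G \<xi> i i)" using n by (simp add: stieltjes_def)
    have "(\<Sum>i<n. \<Sum>j<n. Q i j \<xi>) = (\<Sum>i<n. G \<xi> i i) * (\<Sum>j<n. G \<xi> j j) * cnj (F \<xi>)"
      by (simp only: Q_def sum_product) (simp only: sum_distrib_right)
    moreover have "(\<Sum>i<n. \<Sum>j<n. of_nat n * (of_real (wigner n p \<xi> i j) * (G \<xi> j i * cnj (F \<xi>))))
        = of_nat n * (of_nat n * (1 + \<i> * of_real y * s \<xi>)) * cnj (F \<xi>)"
      unfolding resolvent_trace_equation sum_distrib_left sum_distrib_right by (simp add: mult.assoc)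
    moreover have "of_nat n * of_nat n * (F \<xi> * z) = of_nat n * (of_nat n * (1 + \<i> * of_real y * s \<xi>)) * z
        + of_real \<sigma>2 * ((of_nat n * s \<xi>) * (of_nat n * s \<xi>) * z)" for z
      by (simp add: equation_defect_def power2_eq_square algebra_simps)
    ultimately show ?thesis by (simp only: ns)
  qed
  have stein: "EE (\<lambda>\<xi>. of_nat n * (of_real (wigner n p \<xi> i j) * (G \<xi> j i * cnj (F \<xi>))))
      = of_real \<sigma>2 * EE (P i j)" if "i < n" "j < n" for i j
  proof (cases "i = j")
    case False
    have "EE (\<lambda>\<xi>. of_nat n * (of_real (wigner n p \<xi> i j) * (G \<xi> j i * cnj (F \<xi>))))
       = EE (\<lambda>\<xi>. of_real (real n * h) * (of_real (of_bool (\<xi> {i, j}) - p) * (G \<xi> j i * cnj (F \<xi>))))"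
      using False by (intro arg_cong[of _ _ EE] ext) (simp add: wigner_def)
    also have "\<dots> = of_real (real n * h) * (of_real \<sigma>2 *
        EE (\<lambda>\<xi>. G (\<xi>({i, j} := True)) j i * cnj (F (\<xi>({i, j} := True)))
         - G (\<xi>({i, j} := False)) j i * cnj (F (\<xi>({i, j} := False)))))"
      by (simp only: ex expect_centred[OF fin p' edge_in_all_edges[OF that False]])
    also have "\<dots> = of_real \<sigma>2 * EE (\<lambda>\<xi>. of_real (real n * h) *
        (G (\<xi>({i, j} := True)) j i * cnj (F (\<xi>({i, j} := True)))
         - G (\<xi>({i, j} := False)) j i * cnj (F (\<xi>({i, j} := False)))))"
      by (simp only: ex mult.left_commute)
    also have "\<dots> = of_real \<sigma>2 * EE (P i j)"
      using False by (intro arg_cong[of _ _ "\<lambda>f. of_real \<sigma>2 * EE f"] ext) (simp add: P_def)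
    finally show ?thesis .
  next
    case True
    then have "P i j = (\<lambda>_. 0)" by (intro ext) (simp add: P_def)
    then show ?thesis using True by (simp add: wigner_def expect_const[OF fin p'])
  qed
  have "of_real (real n * real n * EE (\<lambda>\<xi>. (cmod (F \<xi>))\<^sup>2))
      = EE (\<lambda>\<xi>. of_nat n * of_nat n * (F \<xi> * cnj (F \<xi>)))"
    by (simp add: ex complex_norm_square[symmetric] expect_of_real[OF fin p'] del: of_real_power)
  also have "\<dots> = of_real \<sigma>2 * EE (\<lambda>\<xi>. \<Sum>i<n. \<Sum>j<n. P i j \<xi> + Q i j \<xi>)"
  proof -
    have "EE (\<lambda>\<xi>. of_nat n * of_nat n * (F \<xi> * cnj (F \<xi>)))
      = (\<Sum>i<n. \<Sum>j<n. EE (\<lambda>\<xi>. of_nat n * (of_real (wigner n p \<xi> i j) * (G \<xi> j i * cnj (F \<xi>)))))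
        + EE (\<lambda>\<xi>. of_real \<sigma>2 * (\<Sum>i<n. \<Sum>j<n. Q i j \<xi>))"
      unfolding FF by (simp only: expect_add[OF fin p'] expect_sum[OF fin p'])
    also have "(\<Sum>i<n. \<Sum>j<n. EE (\<lambda>\<xi>. of_nat n * (of_real (wigner n p \<xi> i j) * (G \<xi> j i * cnj (F \<xi>)))))
      = (\<Sum>i<n. \<Sum>j<n. of_real \<sigma>2 * EE (P i j))"
      by (intro sum.cong refl stein) auto
    also have "\<dots> + EE (\<lambda>\<xi>. of_real \<sigma>2 * (\<Sum>i<n. \<Sum>j<n. Q i j \<xi>))
      = of_real \<sigma>2 * EE (\<lambda>\<xi>. \<Sum>i<n. \<Sum>j<n. P i j \<xi> + Q i j \<xi>)"
    proof -
      have "EE (\<lambda>\<xi>. \<Sum>i<n. \<Sum>j<n. P i j \<xi> + Q i j \<xi>)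
          = (\<Sum>i<n. \<Sum>j<n. EE (P i j)) + (\<Sum>i<n. \<Sum>j<n. EE (Q i j))"
        by (simp only: expect_add[OF fin p'] expect_sum[OF fin p'] sum.distrib)
      moreover have "EE (\<lambda>\<xi>. of_real \<sigma>2 * (\<Sum>i<n. \<Sum>j<n. Q i j \<xi>))
          = of_real \<sigma>2 * (\<Sum>i<n. \<Sum>j<n. EE (Q i j))"
        by (simp only: expect_cmult[OF fin p'] expect_sum[OF fin p'])
      moreover have "(\<Sum>i<n. \<Sum>j<n. of_real \<sigma>2 * EE (P i j)) = of_real \<sigma>2 * (\<Sum>i<n. \<Sum>j<n. EE (P i j))"
        by (simp only: sum_distrib_left)
      ultimately show ?thesis by (simp only: distrib_left)
    qed
    finally show ?thesis .
  qed
  finally have eq: "of_real (real n * real n * EE (\<lambda>\<xi>. (cmod (F \<xi>))\<^sup>2))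
      = of_real \<sigma>2 * EE (\<lambda>\<xi>. \<Sum>i<n. \<Sum>j<n. P i j \<xi> + Q i j \<xi>)" .
  have "0 \<le> real n * real n * EE (\<lambda>\<xi>. (cmod (F \<xi>))\<^sup>2)"
    by (intro mult_nonneg_nonneg expect_nonneg[OF fin p']) auto
  then have "real n * real n * EE (\<lambda>\<xi>. (cmod (F \<xi>))\<^sup>2)
      = cmod (of_real (real n * real n * EE (\<lambda>\<xi>. (cmod (F \<xi>))\<^sup>2)))"
    by (simp only: norm_of_real abs_of_nonneg)
  also have "\<dots> = cmod (of_real \<sigma>2 * EE (\<lambda>\<xi>. \<Sum>i<n. \<Sum>j<n. P i j \<xi> + Q i j \<xi>))"
    by (simp only: eq)
  also have "\<dots> \<le> 1 * cmod (EE (\<lambda>\<xi>. \<Sum>i<n. \<Sum>j<n. P i j \<xi> + Q i j \<xi>))"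
    unfolding norm_mult norm_of_real using var by (intro mult_right_mono) auto
  also have "\<dots> \<le> EE (\<lambda>\<xi>. cmod (\<Sum>i<n. \<Sum>j<n. P i j \<xi> + Q i j \<xi>))"
    unfolding mult_1 by (rule norm_expect_le[OF fin p'])
  also have "\<dots> \<le> EE (\<lambda>\<xi>. real n * real n * ((B / y\<^sup>2 + K + B / y\<^sup>2) * h))"
  proof (rule expect_mono[OF fin p'])
    fix \<xi>
    have entry: "cmod (P i j \<xi> + Q i j \<xi>) \<le> B / y * cmod (G \<xi> j i) + K * h + of_bool (i = j) * (B / y\<^sup>2)"
      if "i < n" "j < n" for i j
    proof (cases "i = j")
      case True
      have "cmod (Q i j \<xi>) \<le> 1 / y * (1 / y) * B"
        unfolding Q_def norm_mult using that y F_le B0 by (intro mult_mono G_le) (auto simp: B_def)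
      then have "cmod (Q i j \<xi>) \<le> B / y\<^sup>2" by (simp add: power2_eq_square)
      moreover have "0 \<le> K" using y c_nonneg by (simp add: K_def)
      then have "0 \<le> K * h" using h(1) by (rule mult_nonneg_nonneg)
      moreover have "0 \<le> B / y * cmod (G \<xi> j i)" using B0 y by auto
      ultimately have "cmod (Q i j \<xi>) \<le> B / y * cmod (G \<xi> j i) + K * h + B / y\<^sup>2"
        by linarith
      then show ?thesis using True by (simp add: P_def)
    next
      case False
      with pair_term_bound[OF that False, of \<xi>] show ?thesis by (simp add: P_def Q_def B_def)
    qed
    have "cmod (\<Sum>i<n. \<Sum>j<n. P i j \<xi> + Q i j \<xi>)
      \<le> (\<Sum>i<n. \<Sum>j<n. B / y * cmod (G \<xi> j i) + K * h + of_bool (i = j) * (B / y\<^sup>2))"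
      by (intro order.trans[OF norm_sum] sum_mono entry) auto
    also have "\<dots> = B / y * (\<Sum>j<n. \<Sum>i<n. cmod (G \<xi> j i)) + real n * real n * (K * h) + real n * (B / y\<^sup>2)"
    proof -
      have "(\<Sum>i<n. \<Sum>j<n. of_bool (i = j) * (B / y\<^sup>2)) = (\<Sum>i<n. B / y\<^sup>2)"
      proof (intro sum.cong refl)
        fix i assume "i \<in> {..<n}"
        have "(\<Sum>j<n. of_bool (i = j) * (B / y\<^sup>2)) = (\<Sum>j<n. if j = i then B / y\<^sup>2 else 0)"
          by (intro sum.cong) auto
        then show "(\<Sum>j<n. of_bool (i = j) * (B / y\<^sup>2)) = B / y\<^sup>2" using \<open>i \<in> {..<n}\<close> by simp
      qed
      moreover have "(\<Sum>i<n. \<Sum>j<n. B / y * cmod (G \<xi> j i)) = B / y * (\<Sum>j<n. \<Sum>i<n. cmod (G \<xi> j i))"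
        by (subst sum.swap) (simp add: sum_distrib_left)
      ultimately show ?thesis by (simp add: sum.distrib)
    qed
    also have "\<dots> \<le> B / y * (\<Sum>j<n. real n * h / y) + real n * real n * (K * h) + real n * real n * (h * (B / y\<^sup>2))"
    proof (intro add_mono mult_left_mono sum_mono sum_norm_row_le order.refl)
      have "real n = real n * (real n * (h * h))" using h(3) by simp
      also have "\<dots> \<le> real n * (real n * h)"
        using h by (intro mult_left_mono mult_left_le) auto
      finally have "real n * (B / y\<^sup>2) \<le> real n * (real n * h) * (B / y\<^sup>2)"
        using B0 by (intro mult_right_mono) auto
      then show "real n * (B / y\<^sup>2) \<le> real n * real n * (h * (B / y\<^sup>2))" by (simp add: mult.assoc)
    qed (use B0 y c_nonneg in \<open>auto simp: K_def\<close>)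
    also have "\<dots> = real n * real n * ((B / y\<^sup>2 + K + B / y\<^sup>2) * h)"
      by (simp add: algebra_simps power2_eq_square)
    finally show "cmod (\<Sum>i<n. \<Sum>j<n. P i j \<xi> + Q i j \<xi>) \<le> \<dots>" .
  qed
  also have "\<dots> = real n * real n * ((B / y\<^sup>2 + K + B / y\<^sup>2) * h)" by (rule expect_const[OF fin p'])
  finally have "real n * real n * EE (\<lambda>\<xi>. (cmod (F \<xi>))\<^sup>2) \<le> real n * real n * ((B / y\<^sup>2 + K + B / y\<^sup>2) * h)" .
  then show ?thesis using n unfolding B_def by (simp del: times_divide_eq_left times_divide_eq_right mult_1_right)
qed

text \<open>On the imaginary axis the quadratic equation has one root \<open>i u\<close> in the upper and one root
  \<open>- i u'\<close> in the lower half plane, and \<open>Im s \<ge> 0\<close> bounds the distance to the latter from below by \<open>u'\<close>.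
  Since \<open>\<sigma>\<^sup>2 u' \<ge> y\<close>, the constant of the resulting estimate is one.\<close>

lemma stability_at_i_y:
  defines "u \<equiv> (sqrt (y\<^sup>2 + 4 * \<sigma>2) - y) / (2 * \<sigma>2)"
  shows "\<bar>(1 - y * Im (s \<xi>)) - (1 - y * u)\<bar> \<le> cmod (F \<xi>)"
proof -
  define r where "r = sqrt (y\<^sup>2 + 4 * \<sigma>2)"
  have r2: "r * r = y\<^sup>2 + 4 * \<sigma>2" using var by (simp add: r_def)
  have ry: "r \<ge> y" unfolding r_def using var y by (intro real_le_rsqrt) simp
  define u' where "u' = (r + y) / (2 * \<sigma>2)"
  (* Vieta's formulas for the roots i u and - i u'. *)
  have uu: "\<sigma>2 * (u' - u) = y" "\<sigma>2 * (u * u') = 1"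
  proof -
    have u: "u = (r - y) / (2 * \<sigma>2)" by (simp add: u_def r_def)
    have alg: "v * ((r + y) / (2 * v) - (r - y) / (2 * v)) = y" if "v \<noteq> 0" for v :: real
      using that by (simp add: field_simps)
    show "\<sigma>2 * (u' - u) = y" using var unfolding u u'_def by (intro alg) linarith
    have alg: "v * ((r - y) / (2 * v) * ((r + y) / (2 * v))) = 1" if "v \<noteq> 0" "(r - y) * (r + y) = 4 * v" for v :: real
    proof -
      have "v * ((r - y) / (2 * v) * ((r + y) / (2 * v))) = ((r - y) * (r + y)) / (4 * v)"
        using that(1) by (simp add: field_simps)
      then show ?thesis using that by simp
    qed
    have "(r - y) * (r + y) = 4 * \<sigma>2" using r2 by (simp add: algebra_simps power2_eq_square)
    then show "\<sigma>2 * (u * u') = 1" using var unfolding u u'_def by (intro alg) linarith+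
  qed
  have "F \<xi> = of_real \<sigma>2 * ((s \<xi> - \<i> * of_real u) * (s \<xi> + \<i> * of_real u'))"
  proof -
    have "of_real \<sigma>2 * ((s \<xi> - \<i> * of_real u) * (s \<xi> + \<i> * of_real u'))
       = of_real \<sigma>2 * (s \<xi>)\<^sup>2 + \<i> * of_real (\<sigma>2 * (u' - u)) * s \<xi> + of_real (\<sigma>2 * (u * u'))"
      by (simp add: algebra_simps power2_eq_square)
    then show ?thesis unfolding uu by (simp add: equation_defect_def)
  qed
  then have F: "cmod (F \<xi>) = cmod (s \<xi> - \<i> * of_real u) * (\<sigma>2 * cmod (s \<xi> + \<i> * of_real u'))"
    by (simp only: norm_mult norm_of_real abs_of_pos[OF var(1)] mult.left_commute)
  have "u' \<le> Im (s \<xi> + \<i> * of_real u')" using Im_stieltjes_nonneg[OF symmetric_wigner y] by simp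
  also have "\<dots> \<le> cmod (s \<xi> + \<i> * of_real u')" by (rule order.trans[OF abs_ge_self abs_Im_le_cmod])
  finally have "\<sigma>2 * u' \<le> \<sigma>2 * cmod (s \<xi> + \<i> * of_real u')" using var by (intro mult_left_mono) auto
  moreover have "y \<le> \<sigma>2 * u'" 
  proof -
    have "v * ((r + y) / (2 * v)) = (r + y) / 2" if "v \<noteq> 0" for v :: real
      using that by (simp add: field_simps)
    from this[of \<sigma>2, OF less_imp_neq[OF var(1), symmetric]] have "\<sigma>2 * u' = (r + y) / 2"
      unfolding u'_def .
    then show ?thesis using ry by simp
  qed
  ultimately have y': "y \<le> \<sigma>2 * cmod (s \<xi> + \<i> * of_real u')" by simp
  have "\<bar>(1 - y * Im (s \<xi>)) - (1 - y * u)\<bar> = \<bar>y * (Im (s \<xi>) - u)\<bar>"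
    by (subst abs_minus_commute) (simp add: algebra_simps)
  also have "\<dots> = \<bar>Im (s \<xi> - \<i> * of_real u)\<bar> * y" using y by (simp add: abs_mult)
  also have "\<dots> \<le> cmod (s \<xi> - \<i> * of_real u) * (\<sigma>2 * cmod (s \<xi> + \<i> * of_real u'))"
    using y y' by (intro mult_mono abs_Im_le_cmod) auto
  finally show ?thesis unfolding F .
qed

end

section \<open>Integrals over the half-line\<close>

lemma has_bochner_integral_FTC_atLeast:
  fixes f F :: "real \<Rightarrow> real"
  assumes "f \<in> borel_measurable borel"
    and "\<And>x. 0 \<le> x \<Longrightarrow> DERIV F x :> f x"
    and "\<And>x. 0 \<le> x \<Longrightarrow> 0 \<le> f x"
    and lim: "(F \<longlongrightarrow> T) at_top"
  shows "has_bochner_integral lborel (\<lambda>x. indicator {0..} x * f x) (T - F 0)"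
proof (rule has_bochner_integral_nn_integral)
  have "(\<integral>\<^sup>+x. ennreal (f x) * indicator {0..} x \<partial>lborel) = T - F 0"
    by (rule nn_integral_FTC_atLeast[OF assms])
  also have "(\<lambda>x. ennreal (f x) * indicator {0..} x) = (\<lambda>x. ennreal (indicator {0..} x * f x))"
    by (auto simp: indicator_def)
  finally show "(\<integral>\<^sup>+x. ennreal (indicator {0..} x * f x) \<partial>lborel) = ennreal (T - F 0)" .
  have "F 0 \<le> F x" if "0 \<le> x" for x
    using assms(2,3) that by (intro DERIV_nonneg_imp_nondecreasing[of 0 x F]) (auto intro: order_trans)
  then have "F 0 \<le> T"
    by (intro tendsto_lowerbound[OF lim]) (auto simp: eventually_at_top_linorder)
  then show "0 \<le> T - F 0" by simp
qed (use assms in \<open>auto simp: indicator_def\<close>)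

text \<open>For \<open>x \<noteq> 0\<close> an antiderivative is \<open>\<bar>x\<bar> arctan (y / \<bar>x\<bar>)\<close>.\<close>

lemma coulson_integral:
  "has_bochner_integral lborel (\<lambda>y. indicator {0..} y * (x\<^sup>2 / (x\<^sup>2 + y\<^sup>2))) (\<bar>x\<bar> * (pi / 2))" for x :: real
proof (cases "x = 0")
  case False
  define F where "F = (\<lambda>y. \<bar>x\<bar> * arctan (y / \<bar>x\<bar>))"
  have "has_bochner_integral lborel (\<lambda>y. indicator {0..} y * (x\<^sup>2 / (x\<^sup>2 + y\<^sup>2))) (\<bar>x\<bar> * (pi / 2) - F 0)"
  proof (rule has_bochner_integral_FTC_atLeast)
    fix y :: real
    have "DERIV F y :> \<bar>x\<bar> * ((1 / \<bar>x\<bar>) / (1 + (y / \<bar>x\<bar>)\<^sup>2))"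
      unfolding F_def using False by (auto intro!: derivative_eq_intros simp: divide_inverse)
    also have "\<bar>x\<bar> * ((1 / \<bar>x\<bar>) / (1 + (y / \<bar>x\<bar>)\<^sup>2)) = x\<^sup>2 / (x\<^sup>2 + y\<^sup>2)"
      using False by (simp add: power_divide add_divide_eq_iff)
    finally show "DERIV F y :> x\<^sup>2 / (x\<^sup>2 + y\<^sup>2)" .
  next
    have "filterlim (\<lambda>y. y * inverse \<bar>x\<bar>) at_top at_top"
      using False by (intro filterlim_at_top_mult_tendsto_pos[OF tendsto_const _ filterlim_ident]) auto
    then have "filterlim (\<lambda>y. y / \<bar>x\<bar>) at_top at_top" by (simp add: divide_inverse)
    from filterlim_compose[OF tendsto_arctan_at_top this]
    show "(F \<longlongrightarrow> \<bar>x\<bar> * (pi / 2)) at_top" unfolding F_def by (intro tendsto_intros)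
  qed auto
  then show ?thesis by (simp add: F_def)
qed (simp add: has_bochner_integral_zero)

text \<open>The value of \<open>1 - y Im s(i y)\<close> for the semicircle law of variance \<open>v\<close>, the limit of
  \<open>x\<^sup>2 / (x\<^sup>2 + y\<^sup>2)\<close> averaged over the eigenvalues.\<close>

definition semicircle_mass :: "real \<Rightarrow> real \<Rightarrow> real" where
  "semicircle_mass v y = 1 - y * ((sqrt (y\<^sup>2 + 4 * v) - y) / (2 * v))"

lemma semicircle_mass_nonneg:
  assumes v: "v > 0" and y: "y \<ge> 0"
  shows "0 \<le> semicircle_mass v y"
proof -
  have "(y * sqrt (y\<^sup>2 + 4 * v))\<^sup>2 \<le> (y\<^sup>2 + 2 * v)\<^sup>2"
    using v by (simp add: power_mult_distrib) (simp add: power2_eq_square algebra_simps)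
  then have "y * sqrt (y\<^sup>2 + 4 * v) \<le> y\<^sup>2 + 2 * v"
    by (rule power2_le_imp_le) (use v in simp)
  then show ?thesis using v
    by (simp add: semicircle_mass_def field_simps power2_eq_square)
qed

text \<open>An antiderivative is \<open>y - ((y\<^sup>2 + 4 v) \<surd>(y\<^sup>2 + 4 v) - y\<^sup>3) / (6 v)\<close>. It vanishes at infinity, and at
  \<open>0\<close> it equals \<open>- 4 / 3 \<surd>v\<close>.\<close>

lemma semicircle_integral:
  assumes v: "v > 0"
  shows "has_bochner_integral lborel (\<lambda>y. indicator {0..} y * semicircle_mass v y) (4 / 3 * sqrt v)"
proof -
  define F where "F = (\<lambda>y. y - ((y\<^sup>2 + 4 * v) * sqrt (y\<^sup>2 + 4 * v) - y ^ 3) / (6 * v))"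
  have "has_bochner_integral lborel (\<lambda>y. indicator {0..} y * semicircle_mass v y) (0 - F 0)"
  proof (rule has_bochner_integral_FTC_atLeast)
    show "semicircle_mass v \<in> borel_measurable borel"
      unfolding semicircle_mass_def by measurable
  next
    fix y :: real
    define r where "r = sqrt (y\<^sup>2 + 4 * v)"
    have pos: "y\<^sup>2 + 4 * v > 0" using v by (simp add: add_nonneg_pos)
    have r: "r > 0" "r * r = y\<^sup>2 + 4 * v" using pos by (simp_all add: r_def)
    have d: "DERIV (\<lambda>y. y\<^sup>2 + 4 * v) y :> 2 * y" by (auto intro!: derivative_eq_intros)
    have d3: "DERIV (\<lambda>y. y ^ 3) y :> 3 * y\<^sup>2" by (auto intro!: derivative_eq_intros)
    have "inverse r / 2 * (2 * y) = y / r" using r(1) by (simp add: field_simps)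
    then have s: "DERIV (\<lambda>y. sqrt (y\<^sup>2 + 4 * v)) y :> y / r"
      using DERIV_chain2[OF DERIV_real_sqrt[OF pos] d] by (simp only: r_def)
    have "DERIV F y :> 1 - ((2 * y) * r + (y / r) * (y\<^sup>2 + 4 * v) - 3 * y\<^sup>2) / (6 * v)"
      using DERIV_diff[OF DERIV_ident DERIV_cdivide[OF DERIV_diff[OF DERIV_mult[OF d s] d3], of "6 * v"]]
      unfolding F_def r_def by (simp only: mult.commute)
    also have "(y / r) * (y\<^sup>2 + 4 * v) = y * r" using r by (simp add: r(2)[symmetric])
    also have "1 - ((2 * y) * r + y * r - 3 * y\<^sup>2) / (6 * v) = semicircle_mass v y"
      unfolding semicircle_mass_def r_def[symmetric] using v
      by (simp add: field_simps power2_eq_square)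
    finally show "DERIV F y :> semicircle_mass v y" .
  next
    show "(F \<longlongrightarrow> 0) at_top" unfolding F_def using v by real_asymp
  qed (use semicircle_mass_nonneg[OF v] in auto)
  also have "0 - F 0 = 4 / 3 * sqrt v"
  proof -
    have "sqrt (4 * v) = 2 * sqrt v" by (simp add: real_sqrt_mult)
    then show ?thesis using v by (simp add: F_def field_simps)
  qed
  finally show ?thesis .
qed

lemma cauchy_kernel_integrable: "integrable lborel (\<lambda>y. indicator {0..} y * (2 / (1 + y\<^sup>2) :: real))"
proof -
  have "has_bochner_integral lborel (\<lambda>y. indicator {0..} y * (2 / (1 + y\<^sup>2) :: real)) (2 * (pi / 2) - 2 * arctan 0)"
  proof (rule has_bochner_integral_FTC_atLeast)
    fix y :: real
    show "DERIV (\<lambda>y. 2 * arctan y) y :> 2 / (1 + y\<^sup>2)"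
      by (auto intro!: derivative_eq_intros simp: divide_inverse)
  next
    show "((\<lambda>y. 2 * arctan y) \<longlongrightarrow> 2 * (pi / 2)) at_top"
      by (intro tendsto_intros tendsto_arctan_at_top)
  qed auto
  then show ?thesis by (rule integrable.intros)
qed

section \<open>Energy of the centred adjacency matrix\<close>

definition spectral_mass :: "nat \<Rightarrow> (nat \<Rightarrow> nat \<Rightarrow> real) \<Rightarrow> real \<Rightarrow> real" where
  "spectral_mass n M y = (\<Sum>k<n. (eigval n M k)\<^sup>2 / ((eigval n M k)\<^sup>2 + y\<^sup>2)) / real n"

lemma spectral_mass_measurable [measurable]: "spectral_mass n M \<in> borel_measurable borel"
  unfolding spectral_mass_def by measurable

lemma energy_eq_coulson_integral:
  assumes "symmetric_fn n M"
  shows "has_bochner_integral lborel (\<lambda>y. indicator {0..} y * spectral_mass n M y)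
     (fn_energy n M / real n * (pi / 2))"
proof -
  let ?l = "eigval n M"
  have "has_bochner_integral lborel (\<lambda>y. (\<Sum>k<n. indicator {0..} y * ((?l k)\<^sup>2 / ((?l k)\<^sup>2 + y\<^sup>2))) / real n)
     ((\<Sum>k<n. \<bar>?l k\<bar> * (pi / 2)) / real n)"
    by (intro has_bochner_integral_divide has_bochner_integral_sum coulson_integral)
  moreover have "(\<Sum>k<n. indicator {0..} y * ((?l k)\<^sup>2 / ((?l k)\<^sup>2 + y\<^sup>2))) / real n
      = indicator {0..} y * spectral_mass n M y" for y
    by (simp add: spectral_mass_def sum_distrib_left)
  moreover have "(\<Sum>k<n. \<bar>?l k\<bar> * (pi / 2)) / real n = fn_energy n M / real n * (pi / 2)"
    unfolding fn_energy_eq[OF spectral_decomposition_eigval[OF assms]] sum_distrib_right[symmetric] by simp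
  ultimately show ?thesis by (simp only:)
qed

text \<open>The average over the eigenvalues is at most \<open>1\<close>, which serves for small \<open>y\<close>, and at most
  \<open>1 / y\<^sup>2\<close> times the mean squared eigenvalue, which makes the tail integrable. The bound does not
  depend on \<open>n\<close>, as dominated convergence requires.\<close>

lemma spectral_mass_bounds:
  assumes sym: "symmetric_fn n M" and y: "y \<ge> 0"
    and frob: "(\<Sum>i<n. \<Sum>j<n. (M i j)\<^sup>2) \<le> real n"
  shows "0 \<le> spectral_mass n M y" "spectral_mass n M y \<le> 2 / (1 + y\<^sup>2)"
proof -
  let ?l = "eigval n M"
  show "0 \<le> spectral_mass n M y"
    unfolding spectral_mass_def by (intro divide_nonneg_nonneg sum_nonneg) auto
  show "spectral_mass n M y \<le> 2 / (1 + y\<^sup>2)"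
  proof (cases "n = 0")
    case True
    then show ?thesis by (simp add: spectral_mass_def add_nonneg_nonneg)
  next
    case n: False
    show ?thesis
    proof (cases "y \<le> 1")
      case True
      have "x\<^sup>2 / (x\<^sup>2 + y\<^sup>2) \<le> 1" for x :: real
      proof -
        have "x\<^sup>2 / (x\<^sup>2 + y\<^sup>2) \<le> (x\<^sup>2 + y\<^sup>2) / (x\<^sup>2 + y\<^sup>2)" by (intro divide_right_mono) auto
        also have "\<dots> \<le> 1" by simp
        finally show ?thesis .
      qed
      then have "(\<Sum>k<n. (?l k)\<^sup>2 / ((?l k)\<^sup>2 + y\<^sup>2)) \<le> (\<Sum>k<n. 1)" by (intro sum_mono)
      then have "spectral_mass n M y \<le> 1" using n by (simp add: spectral_mass_def)
      also have "1 \<le> 2 / (1 + y\<^sup>2)"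
      proof -
        have "1 + y\<^sup>2 > 0" by (intro add_pos_nonneg) auto
        then show ?thesis using power_le_one[OF y True, of 2] by (simp add: le_divide_eq)
      qed
      finally show ?thesis .
    next
      case False
      then have y1: "y\<^sup>2 \<ge> 1" "y\<^sup>2 > 0" using y by (auto simp: one_le_power)
      have "(\<Sum>k<n. (?l k)\<^sup>2 / ((?l k)\<^sup>2 + y\<^sup>2)) \<le> (\<Sum>k<n. (?l k)\<^sup>2 / y\<^sup>2)"
        using y1 by (intro sum_mono divide_left_mono mult_pos_pos add_nonneg_pos) auto
      also have "\<dots> = (\<Sum>i<n. \<Sum>j<n. (M i j)\<^sup>2) / y\<^sup>2"
        by (simp add: sum_divide_distrib[symmetric]
            sum_eigenvalues_squared[OF spectral_decomposition_eigval[OF sym]])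
      also have "\<dots> \<le> real n / y\<^sup>2" using frob y1 by (intro divide_right_mono) auto
      finally have "spectral_mass n M y \<le> 1 / y\<^sup>2"
        using n by (simp add: spectral_mass_def divide_le_eq)
      also have "1 / y\<^sup>2 \<le> 2 / (1 + y\<^sup>2)"
        using y1 by (simp add: divide_simps add_nonneg_eq_0_iff)
      finally show ?thesis .
    qed
  qed
qed

context
  fixes p :: real
  assumes p: "0 < p" "p < 1"
begin

private abbreviation (input) "v \<equiv> p * (1 - p)"
private abbreviation (input) "d \<equiv> semicircle_mass v"

private lemma v: "v > 0" using p by simp

lemma wigner_frobenius: "(\<Sum>i<n. \<Sum>j<n. (wigner n p \<xi> i j)\<^sup>2) \<le> real n"
proof -
  have "(wigner n p \<xi> i j)\<^sup>2 \<le> 1 / real n" for i j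
  proof -
    have "(of_bool (\<xi> {i, j}) - p)\<^sup>2 \<le> 1"
      using p by (auto simp: abs_square_le_1)
    then have "(of_bool (\<xi> {i, j}) - p)\<^sup>2 / real n \<le> 1 / real n" by (intro divide_right_mono) auto
    then show ?thesis by (simp add: wigner_def power_divide)
  qed
  then have "(\<Sum>i<n. \<Sum>j<n. (wigner n p \<xi> i j)\<^sup>2) \<le> (\<Sum>i<n. \<Sum>j<n. 1 / real n)"
    by (intro sum_mono)
  also have "\<dots> = real n" by (cases "n = 0") auto
  finally show ?thesis .
qed

lemma expect_spectral_mass_tendsto:
  assumes y: "y > 0"
  shows "(\<lambda>n. expect (all_edges n) p (\<lambda>\<xi>. \<bar>spectral_mass n (wigner n p \<xi>) y - d y\<bar>)) \<longlonglongrightarrow> 0"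
proof -
  have p': "0 \<le> p" "p \<le> 1" using p by auto
  obtain C where C: "\<And>n. n > 0 \<Longrightarrow> expect (all_edges n) p (\<lambda>\<xi>. (cmod (equation_defect n p y \<xi>))\<^sup>2) \<le> C * (1 / sqrt (real n))"
    using expect_defect_squared_le[OF _ p y] by blast
  have le: "expect (all_edges n) p (\<lambda>\<xi>. \<bar>spectral_mass n (wigner n p \<xi>) y - d y\<bar>) \<le> sqrt (C * (1 / sqrt (real n)))"
    if n: "n > 0" for n
  proof -
    have "expect (all_edges n) p (\<lambda>\<xi>. \<bar>spectral_mass n (wigner n p \<xi>) y - d y\<bar>)
       \<le> expect (all_edges n) p (\<lambda>\<xi>. cmod (equation_defect n p y \<xi>))"
      using stability_at_i_y[OF n p y] one_minus_y_Im_stieltjes[OF symmetric_wigner y n]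
      by (intro expect_mono[OF finite_all_edges p'])
        (simp add: spectral_mass_def semicircle_mass_def)
    also have "\<dots> \<le> sqrt (expect (all_edges n) p (\<lambda>\<xi>. (cmod (equation_defect n p y \<xi>))\<^sup>2))"
      by (rule expect_le_sqrt[OF finite_all_edges p'])
    also have "\<dots> \<le> sqrt (C * (1 / sqrt (real n)))" using C[OF n] by simp
    finally show ?thesis .
  qed
  have "(\<lambda>n. sqrt (C * (1 / sqrt (real n)))) \<longlonglongrightarrow> sqrt (C * 0)"
    by (intro tendsto_intros real_tendsto_divide_at_top[OF tendsto_const]
        filterlim_compose[OF sqrt_at_top filterlim_real_sequentially])
  then have lim: "(\<lambda>n. sqrt (C * (1 / sqrt (real n)))) \<longlonglongrightarrow> 0" by simp
  show ?thesis
    by (rule tendsto_sandwich[OF _ _ tendsto_const lim])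
      (use le expect_nonneg[OF finite_all_edges p'] in \<open>auto intro!: eventually_sequentiallyI[of 1]\<close>)
qed

lemma expect_energy_deviation_le_integral:
  assumes n: "n > 0"
  shows "expect (all_edges n) p (\<lambda>\<xi>. \<bar>fn_energy n (wigner n p \<xi>) / real n - 8 / (3 * pi) * sqrt v\<bar>)
    \<le> 2 / pi * (\<integral>y. indicator {0..} y * expect (all_edges n) p (\<lambda>\<xi>. \<bar>spectral_mass n (wigner n p \<xi>) y - d y\<bar>) \<partial>lborel)"
proof -
  have p': "0 \<le> p" "p \<le> 1" using p by auto
  note fin = finite_all_edges[of n]
  let ?g = "\<lambda>\<xi>. spectral_mass n (wigner n p \<xi>)"
  have hb: "has_bochner_integral lborel (\<lambda>y. indicator {0..} y * (?g \<xi> y - d y))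
      (fn_energy n (wigner n p \<xi>) / real n * (pi / 2) - 4 / 3 * sqrt v)" for \<xi>
    using has_bochner_integral_diff[OF energy_eq_coulson_integral[OF symmetric_wigner] semicircle_integral[OF v]]
    by (simp add: right_diff_distrib)
  have int: "integrable lborel (\<lambda>y. indicator {0..} y * \<bar>?g \<xi> y - d y\<bar>)" for \<xi>
  proof -
    have "integrable lborel (\<lambda>y. \<bar>indicator {0..} y * (?g \<xi> y - d y)\<bar>)"
      using hb by (intro integrable_abs) (rule integrable.intros)
    then show ?thesis by (simp add: abs_mult)
  qed
  have "\<bar>fn_energy n (wigner n p \<xi>) / real n - 8 / (3 * pi) * sqrt v\<bar>
      \<le> 2 / pi * (\<integral>y. indicator {0..} y * \<bar>?g \<xi> y - d y\<bar> \<partial>lborel)" for \<xi>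
  proof -
    have "fn_energy n (wigner n p \<xi>) / real n - 8 / (3 * pi) * sqrt v
       = 2 / pi * (\<integral>y. indicator {0..} y * (?g \<xi> y - d y) \<partial>lborel)"
      unfolding has_bochner_integral_integral_eq[OF hb] by (simp add: field_simps)
    also have "\<bar>\<dots>\<bar> = 2 / pi * \<bar>\<integral>y. indicator {0..} y * (?g \<xi> y - d y) \<partial>lborel\<bar>"
      by (simp add: abs_mult)
    also have "\<dots> \<le> 2 / pi * (\<integral>y. \<bar>indicator {0..} y * (?g \<xi> y - d y)\<bar> \<partial>lborel)"
      by (intro mult_left_mono integral_abs_bound) auto
    finally show ?thesis by (simp add: abs_mult)
  qed
  then have "expect (all_edges n) p (\<lambda>\<xi>. \<bar>fn_energy n (wigner n p \<xi>) / real n - 8 / (3 * pi) * sqrt v\<bar>)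
     \<le> expect (all_edges n) p (\<lambda>\<xi>. 2 / pi * (\<integral>y. indicator {0..} y * \<bar>?g \<xi> y - d y\<bar> \<partial>lborel))"
    by (rule expect_mono[OF fin p'])
  also have "\<dots> = 2 / pi * expect (all_edges n) p (\<lambda>\<xi>. \<integral>y. indicator {0..} y * \<bar>?g \<xi> y - d y\<bar> \<partial>lborel)"
    by (rule expect_cmult[OF fin p'])
  also have "expect (all_edges n) p (\<lambda>\<xi>. \<integral>y. indicator {0..} y * \<bar>?g \<xi> y - d y\<bar> \<partial>lborel)
     = (\<integral>y. expect (all_edges n) p (\<lambda>\<xi>. indicator {0..} y * \<bar>?g \<xi> y - d y\<bar>) \<partial>lborel)"
    unfolding expect_eq_sum[OF fin p'] using int by simp
  also have "\<dots> = (\<integral>y. indicator {0..} y * expect (all_edges n) p (\<lambda>\<xi>. \<bar>?g \<xi> y - d y\<bar>) \<partial>lborel)"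
    by (simp only: expect_cmult[OF fin p'])
  finally show ?thesis .
qed

text \<open>Dominated convergence under Coulson's integral. The point \<open>y = 0\<close> is excluded as a null set:
  there the bounds on the resolvent degenerate.\<close>

theorem expect_energy_deviation_tendsto:
  "(\<lambda>n. expect (all_edges n) p (\<lambda>\<xi>. \<bar>fn_energy n (wigner n p \<xi>) / real n - 8 / (3 * pi) * sqrt v\<bar>)) \<longlonglongrightarrow> 0"
proof -
  have p': "0 \<le> p" "p \<le> 1" using p by auto
  let ?e = "\<lambda>n y. expect (all_edges n) p (\<lambda>\<xi>. \<bar>spectral_mass n (wigner n p \<xi>) y - d y\<bar>)"
  have [measurable]: "d \<in> borel_measurable borel"
    unfolding semicircle_mass_def by measurable
  have [measurable]: "?e n \<in> borel_measurable borel" for n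
    unfolding expect_eq_sum[OF finite_all_edges p'] by measurable
  have "(\<lambda>n. \<integral>y. indicator {0..} y * ?e n y \<partial>lborel) \<longlonglongrightarrow> (\<integral>y. 0 \<partial>(lborel :: real measure))"
  proof (rule integral_dominated_convergence)
    show "integrable lborel (\<lambda>y. indicator {0..} y * (2 / (1 + y\<^sup>2)) + indicator {0..} y * d y)"
      using cauchy_kernel_integrable integrable.intros[OF semicircle_integral[OF v]]
      by (rule Bochner_Integration.integrable_add)
    have "AE y in lborel. y \<noteq> (0::real)" by (rule AE_lborel_singleton)
    then show "AE y in lborel. (\<lambda>n. indicator {0..} y * ?e n y) \<longlonglongrightarrow> 0"
    proof eventually_elim
      case (elim y)
      show ?case
      proof (cases "y > 0")
        case True
        then show ?thesis using expect_spectral_mass_tendsto[OF True] by simp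
      qed (use elim in simp)
    qed
    show "AE y in lborel. norm (indicator {0..} y * ?e n y) \<le> indicator {0..} y * (2 / (1 + y\<^sup>2)) + indicator {0..} y * d y" for n
    proof (rule AE_I2)
      fix y :: real
      show "norm (indicator {0..} y * ?e n y) \<le> indicator {0..} y * (2 / (1 + y\<^sup>2)) + indicator {0..} y * d y"
      proof (cases "y \<ge> 0")
        case y: True
        have "\<bar>spectral_mass n (wigner n p \<xi>) y - d y\<bar> \<le> 2 / (1 + y\<^sup>2) + d y" for \<xi>
          using spectral_mass_bounds[OF symmetric_wigner y wigner_frobenius, of n \<xi>]
            semicircle_mass_nonneg[OF v y] by linarith
        from expect_mono[OF finite_all_edges p' this]
        have "?e n y \<le> 2 / (1 + y\<^sup>2) + d y" by (simp add: expect_const[OF finite_all_edges p'])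
        moreover have "0 \<le> ?e n y" by (intro expect_nonneg[OF finite_all_edges p']) auto
        ultimately show ?thesis using y by simp
      qed simp
    qed
  qed auto
  then have "(\<lambda>n. 2 / pi * (\<integral>y. indicator {0..} y * ?e n y \<partial>lborel)) \<longlonglongrightarrow> 2 / pi * 0"
    by (intro tendsto_intros) simp
  then have lim: "(\<lambda>n. 2 / pi * (\<integral>y. indicator {0..} y * ?e n y \<partial>lborel)) \<longlonglongrightarrow> 0" by simp
  show ?thesis
    by (rule tendsto_sandwich[OF _ _ tendsto_const lim])
      (use expect_energy_deviation_le_integral expect_nonneg[OF finite_all_edges p']
        in \<open>auto intro!: eventually_sequentiallyI[of 1]\<close>)
qed

end

section \<open>Degrees and distances\<close>

definition graph_of :: "nat \<Rightarrow> (nat set \<Rightarrow> bool) \<Rightarrow> nat set set" where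
  "graph_of n \<xi> = {e \<in> all_edges n. \<xi> e}"

lemma edge_graph_of_iff: "i < n \<Longrightarrow> j < n \<Longrightarrow> {i, j} \<in> graph_of n \<xi> \<longleftrightarrow> i \<noteq> j \<and> \<xi> {i, j}"
  by (auto simp: graph_of_def all_edges_def card_2_iff doubleton_eq_iff)

lemma real_degree_eq:
  assumes "i < n"
  shows "real (degree_in (graph_of n \<xi>) i) = (\<Sum>j\<in>{..<n} - {i}. of_bool (\<xi> {i, j}))"
proof -
  have "bij_betw (\<lambda>j. {i, j}) {j\<in>{..<n} - {i}. \<xi> {i, j}} {e \<in> graph_of n \<xi>. i \<in> e}"
  proof (rule bij_betwI')
    fix e assume "e \<in> {e \<in> graph_of n \<xi>. i \<in> e}"
    then have "card e = 2" "i \<in> e" "e \<subseteq> {..<n}" "\<xi> e" by (auto simp: graph_of_def all_edges_def)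
    then obtain j where "e = {i, j}" "j \<noteq> i" by (auto simp: card_2_iff)
    with \<open>e \<subseteq> {..<n}\<close> \<open>\<xi> e\<close> show "\<exists>j\<in>{j\<in>{..<n} - {i}. \<xi> {i, j}}. e = {i, j}" by auto
  qed (use assms in \<open>auto simp: edge_graph_of_iff doubleton_eq_iff\<close>)
  then have "degree_in (graph_of n \<xi>) i = card {j\<in>{..<n} - {i}. \<xi> {i, j}}"
    unfolding degree_in_def by (rule bij_betw_same_card[symmetric])
  then show ?thesis by (simp add: of_bool_def sum.If_cases Int_def)
qed

text \<open>The degree counts \<open>n - 1\<close> possible neighbours, whence the extra \<open>p\<close>.\<close>

lemma degree_deviation:
  assumes "i < n"
  shows "real (degree_in (graph_of n \<xi>) i) - real n * p = sqrt (real n) * (\<Sum>j<n. wigner n p \<xi> i j) - p"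
proof -
  have "(\<Sum>j<n. wigner n p \<xi> i j) = (\<Sum>j\<in>{..<n} - {i}. wigner n p \<xi> i j)"
    using assms by (intro sum.mono_neutral_right) (auto simp: wigner_def)
  also have "sqrt (real n) * \<dots> = (\<Sum>j\<in>{..<n} - {i}. of_bool (\<xi> {i, j}) - p)"
    unfolding sum_distrib_left using assms by (intro sum.cong) (auto simp: wigner_def)
  also have "\<dots> = real (degree_in (graph_of n \<xi>) i) - (real n - 1) * p"
    using assms by (simp add: real_degree_eq sum_subtractf card_Diff_singleton of_nat_diff)
  finally show ?thesis by (simp add: algebra_simps)
qed

lemma graph_dist_self [simp]: "graph_dist E i i = 0"
proof -
  have "is_path E i [i] i" by (simp add: is_path_def)
  then have "(LEAST k. \<exists>xs. is_path E i xs i \<and> length xs = Suc k) = 0"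
    by (intro Least_eq_0 exI[of _ "[i]"]) simp
  then show ?thesis by (simp add: graph_dist_def)
qed

lemma is_path_length_1: "is_path E i xs j \<Longrightarrow> length xs = Suc 0 \<Longrightarrow> i = j"
  by (cases xs) (auto simp: is_path_def)

lemma is_path_length_2: "is_path E i xs j \<Longrightarrow> length xs = Suc (Suc 0) \<Longrightarrow> {i, j} \<in> E"
  by (cases xs; cases "tl xs") (auto simp: is_path_def)

lemma graph_dist_adjacent:
  assumes "i \<noteq> j" "{i, j} \<in> E"
  shows "graph_dist E i j = 1"
proof -
  have P: "is_path E i [i, j] j" using assms by (simp add: is_path_def)
  have "(LEAST k. \<exists>xs. is_path E i xs j \<and> length xs = Suc k) = 1"
  proof (rule Least_equality)
    show "\<exists>xs. is_path E i xs j \<and> length xs = Suc 1" using P by (intro exI[of _ "[i, j]"]) simp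
    fix k assume "\<exists>xs. is_path E i xs j \<and> length xs = Suc k"
    then show "1 \<le> k" using is_path_length_1[of E i _ j] assms by (cases k) auto
  qed
  then show ?thesis using P by (auto simp: graph_dist_def)
qed

lemma graph_dist_common_neighbour:
  assumes "i \<noteq> j" "{i, j} \<notin> E" "{i, w} \<in> E" "{w, j} \<in> E" "w \<noteq> i" "w \<noteq> j"
  shows "graph_dist E i j = 2"
proof -
  have P: "is_path E i [i, w, j] j" using assms by (auto simp: is_path_def)
  have "(LEAST k. \<exists>xs. is_path E i xs j \<and> length xs = Suc k) = 2"
  proof (rule Least_equality)
    show "\<exists>xs. is_path E i xs j \<and> length xs = Suc 2" using P by (intro exI[of _ "[i, w, j]"]) simp
    fix k assume *: "\<exists>xs. is_path E i xs j \<and> length xs = Suc k"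
    from * obtain xs where xs: "is_path E i xs j" "length xs = Suc k" by blast
    have "k \<noteq> 0" using is_path_length_1[OF xs(1)] xs(2) assms(1) by metis
    moreover have "k \<noteq> Suc 0" using is_path_length_2[OF xs(1)] xs(2) assms(2) by metis
    ultimately show "2 \<le> k" by simp
  qed
  then show ?thesis using P by (auto simp: graph_dist_def)
qed

lemma is_path_rev: "is_path E i xs j \<Longrightarrow> is_path E j (rev xs) i"
  by (auto simp: is_path_def hd_rev last_rev successively_rev insert_commute)

lemma graph_dist_sym: "graph_dist E i j = graph_dist E j i"
proof -
  have "(\<exists>xs. is_path E i xs j \<and> P (length xs)) \<longleftrightarrow> (\<exists>xs. is_path E j xs i \<and> P (length xs))" for P
    by (metis is_path_rev length_rev)
  from this[of "\<lambda>_. True"] this[of "\<lambda>l. l = Suc k" for k] show ?thesis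
    unfolding graph_dist_def by simp
qed

definition diameter_le_2 :: "nat \<Rightarrow> (nat set \<Rightarrow> bool) \<Rightarrow> bool" where
  "diameter_le_2 n \<xi> \<longleftrightarrow> (\<forall>i<n. \<forall>j<n. i \<noteq> j \<longrightarrow>
      \<xi> {i, j} \<or> (\<exists>w\<in>{..<n} - {i, j}. \<xi> {i, w} \<and> \<xi> {w, j}))"

lemma graph_dist_diameter_le_2:
  assumes d: "diameter_le_2 n \<xi>" and ij: "i < n" "j < n" "i \<noteq> j"
  shows "real (graph_dist (graph_of n \<xi>) i j) = 2 - of_bool (\<xi> {i, j})"
proof (cases "\<xi> {i, j}")
  case True
  then show ?thesis using ij graph_dist_adjacent[of i j "graph_of n \<xi>"] by (simp add: edge_graph_of_iff)
next
  case False
  then obtain w where w: "w < n" "w \<noteq> i" "w \<noteq> j" "\<xi> {i, w}" "\<xi> {w, j}"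
    using d ij by (auto simp: diameter_le_2_def)
  then have "graph_dist (graph_of n \<xi>) i j = 2"
    using False ij by (intro graph_dist_common_neighbour[of _ _ _ w]) (auto simp: edge_graph_of_iff)
  then show ?thesis using False by simp
qed

definition degree_defect :: "nat \<Rightarrow> real \<Rightarrow> (nat set \<Rightarrow> bool) \<Rightarrow> real" where
  "degree_defect n p \<xi> = (\<Sum>i<n. (real (degree_in (graph_of n \<xi>) i) - real n * p)\<^sup>2)"

text \<open>Off the diagonal \<open>DD = (d\<^sub>i + d\<^sub>j) D\<close>. Replacing the degrees by \<open>n p\<close> costs \<open>R\<close>, which is small in
  Frobenius norm; the rest is \<open>2 n p D\<close> with \<open>D = 2 - p - \<surd>n W\<close>, a constant matrix plus a multiple
  of \<open>W\<close>. The constant matrix also fills the diagonal, which \<open>R\<close> has to undo.\<close>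

lemma energy_DD_approx:
  assumes p: "0 < p" "p < 1" and d: "diameter_le_2 n \<xi>" and n: "n > 0"
  shows "\<bar>energy (DD_mat n (graph_of n \<xi>)) - 2 * p * (real n * sqrt (real n)) * fn_energy n (wigner n p \<xi>)\<bar>
     \<le> 4 * (real n)\<^sup>2 + sqrt (16 * (real n)\<^sup>2 * degree_defect n p \<xi> + 16 * (real n) ^ 4)"
proof -
  let ?E = "graph_of n \<xi>" and ?W = "wigner n p \<xi>"
  define dg where "dg i = real (degree_in ?E i) - real n * p" for i
  define D where "D i j = real ((degree_in ?E i + degree_in ?E j) * graph_dist ?E i j)" for i j
  define b where "b = 2 * p * (real n * sqrt (real n))"
  define c where "c = 2 * real n * p * (2 - p)"
  define R where "R i j = D i j + b * ?W i j - c" for i j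
  have b0: "b \<ge> 0" using p by (simp add: b_def)
  have c: "0 \<le> c" "c \<le> 4 * real n"
  proof -
    have "p * (2 - p) \<le> 1 * 2" using p by (intro mult_mono) auto
    then have "real n * (p * (2 - p)) \<le> real n * 2" by (intro mult_left_mono) auto
    then show "c \<le> 4 * real n" by (simp add: c_def algebra_simps)
  qed (use p in \<open>simp add: c_def\<close>)
  have symD: "symmetric_fn n D"
    by (auto simp: symmetric_fn_def D_def add.commute graph_dist_sym[of ?E])
  have symW: "symmetric_fn n ?W" by (rule symmetric_wigner)
  have symB: "symmetric_fn n (\<lambda>i j. - b * ?W i j)" using symW by (simp add: symmetric_fn_def)
  have symR: "symmetric_fn n R" using symD symW by (simp add: symmetric_fn_def R_def)
  have symc: "symmetric_fn n (\<lambda>_ _. c)" by (simp add: symmetric_fn_def)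
  (* On the diagonal the distance is 0, so the entry of R is - c. *)
  have R: "(R i j)\<^sup>2 \<le> 8 * (dg i)\<^sup>2 + 8 * (dg j)\<^sup>2 + of_bool (i = j) * (16 * (real n)\<^sup>2)" if "i < n" "j < n" for i j
  proof (cases "i = j")
    case True
    then have "(R i j)\<^sup>2 = c\<^sup>2" by (simp add: R_def D_def wigner_def)
    also have "\<dots> \<le> (4 * real n)\<^sup>2" using c by (intro power_mono) auto
    finally have "(R i j)\<^sup>2 \<le> 16 * (real n)\<^sup>2" by (simp add: power_mult_distrib)
    moreover have "of_bool (i = j) * (16 * (real n)\<^sup>2) = 16 * (real n)\<^sup>2" using True by simp
    ultimately show ?thesis using zero_le_power2[of "dg i"] zero_le_power2[of "dg j"] by linarith
  next
    case False
    define t where "t = real (graph_dist ?E i j)"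
    have t: "t = 2 - of_bool (\<xi> {i, j})"
      unfolding t_def by (rule graph_dist_diameter_le_2[OF d that False])
    have "sqrt (real n) * ?W i j = 2 - p - t" using n False by (simp add: wigner_def t)
    then have "b * ?W i j = 2 * p * real n * (2 - p - t)" by (simp add: b_def mult.assoc)
    then have "R i j = (dg i + dg j) * t"
      by (simp add: R_def D_def c_def dg_def t_def[symmetric] algebra_simps)
    then have "(R i j)\<^sup>2 = (dg i + dg j)\<^sup>2 * t\<^sup>2" by (simp add: power_mult_distrib)
    also have "\<dots> \<le> (2 * (dg i)\<^sup>2 + 2 * (dg j)\<^sup>2) * 4"
    proof (intro mult_mono)
      show "(dg i + dg j)\<^sup>2 \<le> 2 * (dg i)\<^sup>2 + 2 * (dg j)\<^sup>2"
        using sum_squares_bound[of "dg i" "dg j"] by (simp add: power2_sum)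
      show "t\<^sup>2 \<le> 4" by (auto simp: t)
    qed auto
    finally show ?thesis using False by simp
  qed
  have "(\<Sum>i<n. \<Sum>j<n. (R i j)\<^sup>2) \<le> (\<Sum>i<n. \<Sum>j<n. 8 * (dg i)\<^sup>2 + 8 * (dg j)\<^sup>2 + of_bool (i = j) * (16 * (real n)\<^sup>2))"
    by (intro sum_mono R) auto
  also have "\<dots> = 16 * real n * (\<Sum>i<n. (dg i)\<^sup>2) + 16 * (real n) ^ 3"
  proof -
    have "(\<Sum>j<n. of_bool (i = j) * (16 * (real n)\<^sup>2)) = 16 * (real n)\<^sup>2" if "i < n" for i
    proof -
      have "(\<Sum>j<n. of_bool (i = j) * (16 * (real n)\<^sup>2)) = (\<Sum>j<n. if j = i then 16 * (real n)\<^sup>2 else 0)"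
        by (intro sum.cong) auto
      then show ?thesis using that by simp
    qed
    then show ?thesis
      by (simp add: sum.distrib sum_distrib_left[symmetric] power2_eq_square power3_eq_cube)
  qed
  finally have R2: "(\<Sum>i<n. \<Sum>j<n. (R i j)\<^sup>2) \<le> 16 * real n * degree_defect n p \<xi> + 16 * (real n) ^ 3"
    by (simp add: dg_def degree_defect_def)
  have "fn_energy n R \<le> sqrt (real n * (\<Sum>i<n. \<Sum>j<n. (R i j)\<^sup>2))"
    by (rule fn_energy_le_frobenius[OF symR])
  also have "\<dots> \<le> sqrt (real n * (16 * real n * degree_defect n p \<xi> + 16 * (real n) ^ 3))"
    using R2 by (intro real_sqrt_le_mono mult_left_mono) auto
  also have "real n * (16 * real n * degree_defect n p \<xi> + 16 * (real n) ^ 3)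
      = 16 * (real n)\<^sup>2 * degree_defect n p \<xi> + 16 * (real n) ^ 4"
    by (simp add: algebra_simps power2_eq_square power3_eq_cube power4_eq_xxxx)
  finally have eR: "fn_energy n R \<le> sqrt (16 * (real n)\<^sup>2 * degree_defect n p \<xi> + 16 * (real n) ^ 4)" .
  have "energy (DD_mat n ?E) = fn_energy n D"
    by (simp add: DD_mat_def fn_energy_def D_def)
  moreover have "fn_energy n (\<lambda>i j. - b * ?W i j) = b * fn_energy n ?W"
    unfolding fn_energy_cmult[OF symW] using b0 by simp
  ultimately have "\<bar>energy (DD_mat n ?E) - b * fn_energy n ?W\<bar> \<le> fn_energy n (\<lambda>i j. D i j - - b * ?W i j)"
    using fn_energy_diff_le[OF symD symB] by simp
  also have "\<dots> = fn_energy n (\<lambda>i j. c + R i j)" by (intro fn_energy_cong) (simp add: R_def)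
  also have "\<dots> \<le> fn_energy n (\<lambda>_ _. c) + fn_energy n R" by (rule fn_energy_triangle[OF symc symR])
  also have "\<dots> \<le> 4 * (real n)\<^sup>2 + sqrt (16 * (real n)\<^sup>2 * degree_defect n p \<xi> + 16 * (real n) ^ 4)"
  proof (intro add_mono eR)
    have "\<bar>c\<bar> * real n \<le> 4 * real n * real n" using c by (intro mult_right_mono) auto
    then show "fn_energy n (\<lambda>_ _. c) \<le> 4 * (real n)\<^sup>2"
      using fn_energy_constant_le[of n c] by (simp add: power2_eq_square)
  qed
  finally show ?thesis unfolding b_def .
qed

context
  fixes n :: nat and p :: real
  assumes p: "0 < p" "p < 1" and n: "n > 0"
begin

private lemma p': "0 \<le> p" "p \<le> 1" using p by auto

text \<open>Distinct entries of a row belong to distinct edges and are uncorrelated.\<close>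

lemma expect_wigner_row_squared_le:
  assumes i: "i < n"
  shows "expect (all_edges n) p (\<lambda>\<xi>. (\<Sum>j<n. wigner n p \<xi> i j)\<^sup>2) \<le> 1"
proof -
  note fin = finite_all_edges[of n]
  have *: "expect (all_edges n) p (\<lambda>\<xi>. wigner n p \<xi> i j * wigner n p \<xi> i k) \<le> (if k = j then 1 / real n else 0)"
    if "j < n" "k < n" for j k
  proof (cases "i = j \<or> k = j")
    case True
    have "(wigner n p \<xi> i j)\<^sup>2 \<le> 1 / real n" for \<xi>
    proof -
      have "(of_bool (\<xi> {i, j}) - p)\<^sup>2 \<le> 1" using p by (auto simp: abs_square_le_1)
      then have "(of_bool (\<xi> {i, j}) - p)\<^sup>2 / real n \<le> 1 / real n" by (intro divide_right_mono) auto
      then show ?thesis by (simp add: wigner_def power_divide)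
    qed
    then have "wigner n p \<xi> i j * wigner n p \<xi> i k \<le> (if k = j then 1 / real n else 0)" for \<xi>
      using True by (auto simp: power2_eq_square) (simp add: wigner_def)
    from expect_mono[OF fin p' this] show ?thesis by (simp only: expect_const[OF fin p'])
  next
    case False
    then have ne: "{i, k} \<noteq> {i, j}" by (auto simp: doubleton_eq_iff)
    have "expect (all_edges n) p (\<lambda>\<xi>. wigner n p \<xi> i j * wigner n p \<xi> i k)
      = expect (all_edges n) p (\<lambda>\<xi>. (of_bool (\<xi> {i, j}) - p) * (wigner n p \<xi> i k / sqrt (real n)))"
      using False by (intro arg_cong[of _ _ "expect (all_edges n) p"] ext) (simp add: wigner_def)
    also have "\<dots> = p * (1 - p) * expect (all_edges n) p (\<lambda>\<xi>.
        wigner n p (\<xi>({i, j} := True)) i k / sqrt (real n) - wigner n p (\<xi>({i, j} := False)) i k / sqrt (real n))"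
      using False by (intro expect_centred_real[OF fin p'] edge_in_all_edges i that) auto
    also have "\<dots> = 0"
    proof -
      have "wigner n p (\<xi>({i, j} := b)) i k = wigner n p \<xi> i k" for \<xi> b
        using ne by (cases "i = k") (simp_all add: wigner_def)
      then show ?thesis by (simp add: expect_const[OF fin p'])
    qed
    finally show ?thesis using False by simp
  qed
  have "expect (all_edges n) p (\<lambda>\<xi>. (\<Sum>j<n. wigner n p \<xi> i j)\<^sup>2)
      = (\<Sum>j<n. \<Sum>k<n. expect (all_edges n) p (\<lambda>\<xi>. wigner n p \<xi> i j * wigner n p \<xi> i k))"
    unfolding power2_eq_square sum_product by (simp only: expect_sum[OF fin p'])
  also have "\<dots> \<le> (\<Sum>j<n. \<Sum>k<n. if k = j then 1 / real n else 0)"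
    by (intro sum_mono *) auto
  also have "\<dots> = 1" using n by simp
  finally show ?thesis .
qed

lemma expect_degree_defect_le: "expect (all_edges n) p (degree_defect n p) \<le> 4 * (real n)\<^sup>2"
proof -
  note fin = finite_all_edges[of n]
  have "expect (all_edges n) p (degree_defect n p)
      = (\<Sum>i<n. expect (all_edges n) p (\<lambda>\<xi>. (sqrt (real n) * (\<Sum>j<n. wigner n p \<xi> i j) - p)\<^sup>2))"
    unfolding degree_defect_def by (simp add: expect_sum[OF fin p'] degree_deviation)
  also have "\<dots> \<le> (\<Sum>i<n. expect (all_edges n) p (\<lambda>\<xi>. 2 * real n * (\<Sum>j<n. wigner n p \<xi> i j)\<^sup>2 + 2))"
  proof (intro sum_mono expect_mono[OF fin p'])
    fix i \<xi>
    define S where "S = (\<Sum>j<n. wigner n p \<xi> i j)"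
    have "(a - p)\<^sup>2 \<le> 2 * a\<^sup>2 + 2" for a :: real
    proof -
      have "0 \<le> (a + p)\<^sup>2" by simp
      moreover have "p\<^sup>2 \<le> 1" using p by (simp add: power_le_one)
      ultimately show ?thesis by (simp add: power2_eq_square algebra_simps)
    qed
    from this[of "sqrt (real n) * S"] show "(sqrt (real n) * S - p)\<^sup>2 \<le> 2 * real n * S\<^sup>2 + 2"
      by (simp add: power_mult_distrib)
  qed
  also have "\<dots> = (\<Sum>i<n. 2 * real n * expect (all_edges n) p (\<lambda>\<xi>. (\<Sum>j<n. wigner n p \<xi> i j)\<^sup>2) + 2)"
    by (simp only: expect_add[OF fin p'] expect_cmult[OF fin p'] expect_const[OF fin p'])
  also have "\<dots> \<le> (\<Sum>i<n. 2 * real n * 1 + 2)"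
    by (intro sum_mono add_right_mono mult_left_mono expect_wigner_row_squared_le) auto
  also have "\<dots> \<le> 4 * (real n)\<^sup>2"
  proof -
    have "real n * 1 \<le> real n * real n" using n by (intro mult_left_mono) auto
    then show ?thesis by (simp add: power2_eq_square algebra_simps)
  qed
  finally show ?thesis .
qed

text \<open>The vertices \<open>w\<close> use disjoint pairs of edges, so they are independent; the factors are split off
  one at a time by conditioning on the two edges at \<open>w\<close>.\<close>

lemma expect_no_common_neighbour:
  assumes ij: "i < n" "j < n" "i \<noteq> j" and W: "W \<subseteq> {..<n} - {i, j}"
  shows "expect (all_edges n) p (\<lambda>\<xi>. \<Prod>w\<in>W. 1 - of_bool (\<xi> {i, w}) * of_bool (\<xi> {w, j})) = (1 - p\<^sup>2) ^ card W"
proof -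
  note fin = finite_all_edges[of n]
  have "finite W" using W finite_subset by blast
  then show ?thesis using W
  proof (induction W)
    case empty
    then show ?case by (simp add: expect_const[OF fin p'])
  next
    case (insert w W)
    define Z :: "(nat set \<Rightarrow> bool) \<Rightarrow> real" where
      "Z = (\<lambda>\<xi>. \<Prod>w\<in>W. 1 - of_bool (\<xi> {i, w}) * of_bool (\<xi> {w, j}))"
    have w: "w < n" "w \<noteq> i" "w \<noteq> j" using insert.prems by auto
    have Zi: "Z (\<xi>({i, w} := True)) = Z \<xi>" for \<xi>
      unfolding Z_def using insert.hyps insert.prems w ij
      by (intro prod.cong refl) (auto simp: doubleton_eq_iff)
    have Zj: "Z (\<xi>({w, j} := True)) = Z \<xi>" for \<xi>
      unfolding Z_def using insert.hyps insert.prems w ij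
      by (intro prod.cong refl) (auto simp: doubleton_eq_iff)
    have ne: "{w, j} \<noteq> {i, w}" using w ij by (auto simp: doubleton_eq_iff)
    have "expect (all_edges n) p (\<lambda>\<xi>. \<Prod>w\<in>insert w W. 1 - of_bool (\<xi> {i, w}) * of_bool (\<xi> {w, j}))
       = expect (all_edges n) p (\<lambda>\<xi>. Z \<xi> - of_bool (\<xi> {i, w}) * (of_bool (\<xi> {w, j}) * Z \<xi>))"
      using insert.hyps by (simp add: Z_def algebra_simps)
    also have "\<dots> = expect (all_edges n) p Z
        - expect (all_edges n) p (\<lambda>\<xi>. of_bool (\<xi> {i, w}) * (of_bool (\<xi> {w, j}) * Z \<xi>))"
      by (rule expect_diff[OF fin p'])
    also have "expect (all_edges n) p (\<lambda>\<xi>. of_bool (\<xi> {i, w}) * (of_bool (\<xi> {w, j}) * Z \<xi>))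
        = p *\<^sub>R expect (all_edges n) p (\<lambda>\<xi>. of_bool (\<xi> {w, j}) * Z \<xi>)"
      using ne Zi by (subst expect_edge[OF fin p' edge_in_all_edges]) (use w ij in auto)
    also have "expect (all_edges n) p (\<lambda>\<xi>. of_bool (\<xi> {w, j}) * Z \<xi>) = p *\<^sub>R expect (all_edges n) p Z"
      using Zj by (subst expect_edge[OF fin p' edge_in_all_edges]) (use w ij in auto)
    also have "expect (all_edges n) p Z - p *\<^sub>R p *\<^sub>R expect (all_edges n) p Z = (1 - p\<^sup>2) * expect (all_edges n) p Z"
      by (simp add: algebra_simps power2_eq_square)
    also have "expect (all_edges n) p Z = (1 - p\<^sup>2) ^ card W"
      using insert.IH insert.prems by (simp add: Z_def)
    finally show ?case using insert.hyps by simp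
  qed
qed

lemma prob_not_diameter_le_2:
  "measure_pmf.prob (coin_pmf (all_edges n) p) {\<xi>. \<not> diameter_le_2 n \<xi>} \<le> (real n)\<^sup>2 * (1 - p\<^sup>2) ^ (n - 2)"
proof -
  note fin = finite_all_edges[of n]
  define Z :: "nat \<Rightarrow> nat \<Rightarrow> (nat set \<Rightarrow> bool) \<Rightarrow> real" where
    "Z i j \<xi> = (if i = j then 0 else \<Prod>w\<in>{..<n} - {i, j}. 1 - of_bool (\<xi> {i, w}) * of_bool (\<xi> {w, j}))" for i j \<xi>
  have Z0: "0 \<le> Z i j \<xi>" for i j \<xi>
  proof -
    have "0 \<le> 1 - of_bool a * (of_bool b :: real)" for a b by (cases a; cases b) auto
    then show ?thesis unfolding Z_def by (auto intro!: prod_nonneg simp del: diff_ge_0_iff_ge)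
  qed
  have "of_bool (\<not> diameter_le_2 n \<xi>) \<le> (\<Sum>i<n. \<Sum>j<n. Z i j \<xi>)" for \<xi>
  proof (cases "diameter_le_2 n \<xi>")
    case True
    then show ?thesis by (simp add: sum_nonneg Z0)
  next
    case False
    then obtain i j where ij: "i < n" "j < n" "i \<noteq> j"
      and no: "\<And>w. w \<in> {..<n} - {i, j} \<Longrightarrow> \<not> (\<xi> {i, w} \<and> \<xi> {w, j})"
      unfolding diameter_le_2_def by blast
    have "(\<Prod>w\<in>{..<n} - {i, j}. 1 - of_bool (\<xi> {i, w}) * of_bool (\<xi> {w, j})) = (\<Prod>w\<in>{..<n} - {i, j}. 1 :: real)"
      using no by (intro prod.cong refl) auto
    then have "1 = Z i j \<xi>" using ij by (simp add: Z_def)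
    also have "\<dots> \<le> (\<Sum>j<n. Z i j \<xi>)" using ij Z0 by (intro member_le_sum) auto
    also have "\<dots> \<le> (\<Sum>i<n. \<Sum>j<n. Z i j \<xi>)"
      using ij Z0 by (intro member_le_sum[of i _ "\<lambda>i. \<Sum>j<n. Z i j \<xi>"] sum_nonneg) auto
    finally show ?thesis using False by simp
  qed
  from expect_mono[OF fin p' this]
  have "measure_pmf.prob (coin_pmf (all_edges n) p) {\<xi>. \<not> diameter_le_2 n \<xi>}
      \<le> expect (all_edges n) p (\<lambda>\<xi>. \<Sum>i<n. \<Sum>j<n. Z i j \<xi>)"
    by (simp add: prob_coin_eq_expect[OF fin p'])
  also have "\<dots> = (\<Sum>i<n. \<Sum>j<n. expect (all_edges n) p (Z i j))"
    by (simp only: expect_sum[OF fin p'])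
  also have "\<dots> \<le> (\<Sum>i<n. \<Sum>j<n. (1 - p\<^sup>2) ^ (n - 2))"
  proof (intro sum_mono)
    fix i j assume ij: "i \<in> {..<n}" "j \<in> {..<n}"
    have p2: "0 \<le> 1 - p\<^sup>2" using p by (simp add: power_le_one)
    show "expect (all_edges n) p (Z i j) \<le> (1 - p\<^sup>2) ^ (n - 2)"
    proof (cases "i = j")
      case True
      then have "Z i j = (\<lambda>_. 0)" by (auto simp: Z_def)
      then show ?thesis using p2 by (simp add: expect_const[OF fin p'])
    next
      case False
      then have "Z i j = (\<lambda>\<xi>. \<Prod>w\<in>{..<n} - {i, j}. 1 - of_bool (\<xi> {i, w}) * of_bool (\<xi> {w, j}))"
        by (auto simp: Z_def)
      moreover have "card ({..<n} - {i, j}) = n - 2"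
        using ij False by (subst card_Diff_subset) auto
      ultimately show ?thesis
        using expect_no_common_neighbour[of i j "{..<n} - {i, j}"] ij False by simp
    qed
  qed
  also have "\<dots> = (real n)\<^sup>2 * (1 - p\<^sup>2) ^ (n - 2)" by (simp add: power2_eq_square)
  finally show ?thesis .
qed

end

section \<open>The degree-distance matrix of a random graph\<close>

text \<open>Divide the approximation of the energy by \<open>n\<^sup>5\<^sup>/\<^sup>2 = n\<^sup>2 \<surd>n\<close>.\<close>

lemma energy_of_gnp_close:
  assumes p: "0 < p" "p < 1" and d: "diameter_le_2 n \<xi>" and n: "n > 0"
  shows "\<bar>energy (DD_mat n (graph_of n \<xi>)) / real n powr (5 / 2) - 16 / (3 * pi) * p * sqrt (p * (1 - p))\<bar>
    \<le> 2 * \<bar>fn_energy n (wigner n p \<xi>) / real n - 8 / (3 * pi) * sqrt (p * (1 - p))\<bar>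
      + (4 * (real n)\<^sup>2 + sqrt (16 * (real n)\<^sup>2 * degree_defect n p \<xi> + 16 * (real n) ^ 4)) / real n powr (5 / 2)"
proof -
  define N where "N = real n powr (5 / 2)"
  define en where "en = energy (DD_mat n (graph_of n \<xi>))"
  define w where "w = fn_energy n (wigner n p \<xi>)"
  have N: "N > 0" "N = real n * (real n * sqrt (real n))"
  proof -
    have "real n powr (5 / 2) = real n powr (2 + 1 / 2)" by simp
    also have "\<dots> = real n powr 2 * real n powr (1 / 2)" by (rule powr_add)
    also have "\<dots> = real n * (real n * sqrt (real n))"
      using n by (simp add: powr_half_sqrt power2_eq_square)
    finally show "N = real n * (real n * sqrt (real n))" by (simp add: N_def)
  qed (use n in \<open>simp add: N_def\<close>)
  have main: "2 * p * (real n * sqrt (real n)) * w = N * (2 * p * (w / real n))"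
    unfolding N(2) using n by simp
  have "en / N - 16 / (3 * pi) * p * sqrt (p * (1 - p))
    = (en - 2 * p * (real n * sqrt (real n)) * w) / N + 2 * p * (w / real n - 8 / (3 * pi) * sqrt (p * (1 - p)))"
    unfolding main using N(1) by (simp add: diff_divide_distrib algebra_simps)
  also have "\<bar>\<dots>\<bar> \<le> \<bar>en - 2 * p * (real n * sqrt (real n)) * w\<bar> / N + 2 * p * \<bar>w / real n - 8 / (3 * pi) * sqrt (p * (1 - p))\<bar>"
    using p N(1) by (intro order.trans[OF abs_triangle_ineq]) (simp add: abs_mult)
  also have "\<dots> \<le> (4 * (real n)\<^sup>2 + sqrt (16 * (real n)\<^sup>2 * degree_defect n p \<xi> + 16 * (real n) ^ 4)) / N
     + 2 * 1 * \<bar>w / real n - 8 / (3 * pi) * sqrt (p * (1 - p))\<bar>"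
    using energy_DD_approx[OF p d n] N(1) p
    by (intro add_mono divide_right_mono mult_mono) (auto simp: en_def w_def)
  finally show ?thesis by (simp add: en_def w_def N_def)
qed

text \<open>By Jensen's inequality the square root has expectation at most \<open>9 n\<^sup>2\<close>, which is negligible against
  \<open>n\<^sup>5\<^sup>/\<^sup>2\<close>.\<close>

lemma expect_energy_error_tendsto:
  assumes p: "0 < p" "p < 1"
  defines "Y \<equiv> \<lambda>n \<xi>. 2 * \<bar>fn_energy n (wigner n p \<xi>) / real n - 8 / (3 * pi) * sqrt (p * (1 - p))\<bar>
      + (4 * (real n)\<^sup>2 + sqrt (16 * (real n)\<^sup>2 * degree_defect n p \<xi> + 16 * (real n) ^ 4)) / real n powr (5 / 2)"
  shows "(\<lambda>n. expect (all_edges n) p (Y n)) \<longlonglongrightarrow> 0"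
proof -
  have p': "0 \<le> p" "p \<le> 1" using p by auto
  let ?E = "\<lambda>n. expect (all_edges n) p"
  let ?a = "\<lambda>n. ?E n (\<lambda>\<xi>. \<bar>fn_energy n (wigner n p \<xi>) / real n - 8 / (3 * pi) * sqrt (p * (1 - p))\<bar>)"
  have dd: "degree_defect n p \<xi> \<ge> 0" for n \<xi>
    unfolding degree_defect_def by (intro sum_nonneg) auto
  have Y0: "0 \<le> Y n \<xi>" for n \<xi>
    unfolding Y_def using dd by (intro add_nonneg_nonneg divide_nonneg_nonneg) auto
  have le: "?E n (Y n) \<le> 2 * ?a n + 13 * ((real n)\<^sup>2 / real n powr (5 / 2))" if n: "n > 0" for n
  proof -
    note ex = expect_add[OF finite_all_edges p'] expect_cmult[OF finite_all_edges p'] expect_const[OF finite_all_edges p']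
    let ?q = "\<lambda>\<xi>. 16 * (real n)\<^sup>2 * degree_defect n p \<xi> + 16 * (real n) ^ 4"
    have "?E n (\<lambda>\<xi>. sqrt (?q \<xi>)) \<le> sqrt (?E n (\<lambda>\<xi>. (sqrt (?q \<xi>))\<^sup>2))"
      by (rule expect_le_sqrt[OF finite_all_edges p'])
    also have "(\<lambda>\<xi>. (sqrt (?q \<xi>))\<^sup>2) = ?q" using dd by auto
    also have "?E n ?q = 16 * (real n)\<^sup>2 * ?E n (degree_defect n p) + 16 * (real n) ^ 4"
      by (simp only: ex)
    also have "sqrt \<dots> \<le> sqrt ((9 * (real n)\<^sup>2)\<^sup>2)"
    proof (rule real_sqrt_le_mono)
      have "16 * (real n)\<^sup>2 * ?E n (degree_defect n p) \<le> 16 * (real n)\<^sup>2 * (4 * (real n)\<^sup>2)"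
        using expect_degree_defect_le[OF p n] by (intro mult_left_mono) auto
      also have "\<dots> = 64 * (real n) ^ 4" by (simp add: power2_eq_square power4_eq_xxxx)
      finally have "16 * (real n)\<^sup>2 * ?E n (degree_defect n p) \<le> 64 * (real n) ^ 4" .
      moreover have "(9 * (real n)\<^sup>2)\<^sup>2 = 81 * (real n) ^ 4"
        by (simp add: power2_eq_square power4_eq_xxxx)
      moreover have "(real n) ^ 4 \<ge> 0" by simp
      ultimately show "16 * (real n)\<^sup>2 * ?E n (degree_defect n p) + 16 * (real n) ^ 4 \<le> (9 * (real n)\<^sup>2)\<^sup>2"
        by linarith
    qed
    also have "sqrt ((9 * (real n)\<^sup>2)\<^sup>2) = 9 * (real n)\<^sup>2" by (subst real_sqrt_abs) simp
    finally have s: "?E n (\<lambda>\<xi>. sqrt (?q \<xi>)) \<le> 9 * (real n)\<^sup>2" .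
    define c where "c = 1 / real n powr (5 / 2)"
    have "Y n = (\<lambda>\<xi>. 2 * \<bar>fn_energy n (wigner n p \<xi>) / real n - 8 / (3 * pi) * sqrt (p * (1 - p))\<bar>
        + c * (4 * (real n)\<^sup>2 + sqrt (?q \<xi>)))"
      unfolding Y_def c_def times_divide_eq_left mult_1_left ..
    then have "?E n (Y n) = 2 * ?a n + c * (4 * (real n)\<^sup>2 + ?E n (\<lambda>\<xi>. sqrt (?q \<xi>)))"
      by (simp only: ex)
    also have "\<dots> \<le> 2 * ?a n + c * (4 * (real n)\<^sup>2 + 9 * (real n)\<^sup>2)"
      using s by (intro add_mono mult_left_mono) (auto simp: c_def)
    also have "c * (4 * (real n)\<^sup>2 + 9 * (real n)\<^sup>2) = 13 * ((real n)\<^sup>2 / real n powr (5 / 2))"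
      by (simp add: c_def)
    finally show ?thesis .
  qed
  have "(\<lambda>n. (real n)\<^sup>2 / real n powr (5 / 2)) \<longlonglongrightarrow> 0" by real_asymp
  then have "(\<lambda>n. 2 * ?a n + 13 * ((real n)\<^sup>2 / real n powr (5 / 2))) \<longlonglongrightarrow> 2 * 0 + 13 * 0"
    by (intro tendsto_intros expect_energy_deviation_tendsto[OF p])
  then have lim: "(\<lambda>n. 2 * ?a n + 13 * ((real n)\<^sup>2 / real n powr (5 / 2))) \<longlonglongrightarrow> 0" by simp
  show ?thesis
    by (rule tendsto_sandwich[OF _ _ tendsto_const lim])
      (use le expect_nonneg[OF finite_all_edges p' Y0] in \<open>auto intro!: eventually_sequentiallyI[of 1]\<close>)
qed

lemma gnp_pmf_eq_coin: "gnp_pmf n p = map_pmf (graph_of n) (coin_pmf (all_edges n) p)"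
  by (simp add: gnp_pmf_def coin_pmf_def graph_of_def[abs_def])

theorem corollary3p6:
  fixes p :: real
  assumes "0 < p" and "p < 1"
  shows "\<exists>\<epsilon> :: nat \<Rightarrow> real. \<epsilon> \<longlonglongrightarrow> 0 \<and>
    (\<lambda>n. measure_pmf.prob (gnp_pmf n p)
       {E. \<exists>\<delta> :: real. \<bar>\<delta>\<bar> \<le> \<epsilon> n \<and>
          energy (DD_mat n E) =
            (16 / (3 * pi) * p * sqrt (p * (1 - p)) + \<delta>) * real n powr (5 / 2)})
    \<longlonglongrightarrow> 1"
proof -
  note p = assms
  define Y where "Y = (\<lambda>n \<xi>. 2 * \<bar>fn_energy n (wigner n p \<xi>) / real n - 8 / (3 * pi) * sqrt (p * (1 - p))\<bar>
      + (4 * (real n)\<^sup>2 + sqrt (16 * (real n)\<^sup>2 * degree_defect n p \<xi> + 16 * (real n) ^ 4)) / real n powr (5 / 2))"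
  define m where "m n = expect (all_edges n) p (Y n)" for n
  (* The square root balances Markov's inequality; the second summand keeps the threshold positive. *)
  define \<epsilon> where "\<epsilon> n = sqrt (m n) + 1 / real (Suc n)" for n
  have p': "0 \<le> p" "p \<le> 1" using p by auto
  have Y0: "0 \<le> Y n \<xi>" for n \<xi>
    unfolding Y_def degree_defect_def
    by (intro add_nonneg_nonneg divide_nonneg_nonneg sum_nonneg real_sqrt_ge_zero mult_nonneg_nonneg) auto
  have m0: "0 \<le> m n" for n unfolding m_def by (rule expect_nonneg[OF finite_all_edges p' Y0])
  have m: "m \<longlonglongrightarrow> 0" using expect_energy_error_tendsto[OF p] by (simp add: m_def[abs_def] Y_def)
  have sm: "(\<lambda>n. sqrt (m n)) \<longlonglongrightarrow> 0" using tendsto_real_sqrt[OF m] by simp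
  have "\<epsilon> \<longlonglongrightarrow> 0 + 0" unfolding \<epsilon>_def
    by (intro tendsto_add sm) (use LIMSEQ_inverse_real_of_nat in \<open>simp add: inverse_eq_divide\<close>)
  then have \<epsilon>: "\<epsilon> \<longlonglongrightarrow> 0" by simp
  have \<epsilon>0: "\<epsilon> n > 0" for n unfolding \<epsilon>_def using m0[of n] by (intro add_nonneg_pos) auto
  define S where "S n = {E. \<exists>\<delta> :: real. \<bar>\<delta>\<bar> \<le> \<epsilon> n \<and>
      energy (DD_mat n E) = (16 / (3 * pi) * p * sqrt (p * (1 - p)) + \<delta>) * real n powr (5 / 2)}" for n
  define b where "b n = sqrt (m n) + (real n)\<^sup>2 * (1 - p\<^sup>2) ^ (n - 2)" for n
  have low: "1 - b n \<le> measure_pmf.prob (gnp_pmf n p) (S n)" if n: "n > 0" for n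
  proof -
    let ?P = "coin_pmf (all_edges n) p"
    have sub: "- (graph_of n -` S n) \<subseteq> {\<xi>. Y n \<xi> > \<epsilon> n} \<union> {\<xi>. \<not> diameter_le_2 n \<xi>}"
    proof (intro subsetI, rule ccontr)
      fix \<xi> assume \<xi>: "\<xi> \<in> - (graph_of n -` S n)" and "\<xi> \<notin> {\<xi>. Y n \<xi> > \<epsilon> n} \<union> {\<xi>. \<not> diameter_le_2 n \<xi>}"
      then have d: "diameter_le_2 n \<xi>" and le: "Y n \<xi> \<le> \<epsilon> n" by auto
      have "\<bar>energy (DD_mat n (graph_of n \<xi>)) / real n powr (5 / 2) - 16 / (3 * pi) * p * sqrt (p * (1 - p))\<bar> \<le> \<epsilon> n"
        using energy_of_gnp_close[OF p d n] le unfolding Y_def by linarith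
      moreover have "energy (DD_mat n (graph_of n \<xi>)) = (16 / (3 * pi) * p * sqrt (p * (1 - p)) +
          (energy (DD_mat n (graph_of n \<xi>)) / real n powr (5 / 2) - 16 / (3 * pi) * p * sqrt (p * (1 - p)))) * real n powr (5 / 2)"
        using n by simp
      ultimately have "graph_of n \<xi> \<in> S n" unfolding S_def by blast
      with \<xi> show False by simp
    qed
    have "measure_pmf.prob ?P (- (graph_of n -` S n))
        \<le> measure_pmf.prob ?P ({\<xi>. Y n \<xi> > \<epsilon> n} \<union> {\<xi>. \<not> diameter_le_2 n \<xi>})"
      by (intro measure_pmf.finite_measure_mono sub) auto
    also have "\<dots> \<le> measure_pmf.prob ?P {\<xi>. Y n \<xi> > \<epsilon> n} + measure_pmf.prob ?P {\<xi>. \<not> diameter_le_2 n \<xi>}"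
      by (rule measure_Un_le) auto
    also have "\<dots> \<le> m n / \<epsilon> n + (real n)\<^sup>2 * (1 - p\<^sup>2) ^ (n - 2)"
      unfolding m_def by (intro add_mono prob_coin_markov[OF finite_all_edges p'] prob_not_diameter_le_2[OF p n] Y0 \<epsilon>0)
    also have "m n / \<epsilon> n \<le> sqrt (m n)"
    proof -
      have "m n = sqrt (m n) * sqrt (m n)" using m0 by simp
      also have "\<dots> \<le> sqrt (m n) * \<epsilon> n" unfolding \<epsilon>_def using m0[of n] by (intro mult_left_mono) auto
      finally show ?thesis using \<epsilon>0[of n] by (simp add: divide_le_eq)
    qed
    finally have "measure_pmf.prob ?P (- (graph_of n -` S n)) \<le> b n" by (simp add: b_def)
    moreover have "measure_pmf.prob ?P (- (graph_of n -` S n)) = 1 - measure_pmf.prob ?P (graph_of n -` S n)"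
      using measure_pmf.prob_compl[of "graph_of n -` S n" ?P] by (simp add: Compl_eq_Diff_UNIV)
    ultimately show ?thesis by (simp add: gnp_pmf_eq_coin measure_map_pmf)
  qed
  have "(\<lambda>n. (real n)\<^sup>2 * (1 - p\<^sup>2) ^ (n - 2)) \<longlonglongrightarrow> 0"
  proof (rule LIMSEQ_offset[of _ 2])
    define q where "q = 1 - p\<^sup>2"
    have q: "0 \<le> q" "q < 1" using p by (auto simp: q_def power_le_one)
    show "(\<lambda>n. (real (n + 2))\<^sup>2 * (1 - p\<^sup>2) ^ (n + 2 - 2)) \<longlonglongrightarrow> 0"
    proof (cases "q = 0")
      case False
      with q have "0 < q" "q < 1" by auto
      then have "(\<lambda>n. (real (n + 2))\<^sup>2 * q ^ n) \<longlonglongrightarrow> 0" by real_asymp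
      then show ?thesis by (simp add: q_def)
    next
      case True
      then have "p = 1 \<or> p = -1" by (simp add: q_def power2_eq_1_iff)
      then show ?thesis using p by auto
    qed
  qed
  with sm have "b \<longlonglongrightarrow> 0 + 0" unfolding b_def by (intro tendsto_add)
  then have "(\<lambda>n. 1 - b n) \<longlonglongrightarrow> 1 - (0 + 0)" by (intro tendsto_intros)
  then have lim: "(\<lambda>n. 1 - b n) \<longlonglongrightarrow> 1" by simp
  have "(\<lambda>n. measure_pmf.prob (gnp_pmf n p) (S n)) \<longlonglongrightarrow> 1"
    by (rule tendsto_sandwich[OF _ _ lim tendsto_const])
      (use low in \<open>auto intro!: eventually_sequentiallyI[of 1]\<close>)
  with \<epsilon> show ?thesis unfolding S_def by blast
qed

end
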